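(* Let $x_1,x_2,x_3$ be zero-mean jointly Gaussian random variables that cannot be embedded in a Gauss-Markov tree. Then, for some relabeling (permutation) of $x_1,x_2,x_3$, the following holds: if $\mathbb E[x_3|x_1,x_2]=a_1x_1+a_2x_2$ with $a_1,a_2\in\mathbb R$, then $$a_1\cdot a_2\cdot\mathbb E[x_1x_2]<0.$$
   Context: **Gauss-Markov tree.** A finite tree (connected acyclic undirected graph) together with jointly Gaussian random variables, one per node, such that for every node $v$, conditioned on the variable at $v$, the collections of variables on the different connected components of the tree with $v$ removed are mutually independent. The variables $x_1,x_2,x_3$ can be embedded in such a tree if there is a Gauss-Markov tree (possibly with additional nodes) having three distinct nodes whose variables have the joint distribution of $(x_1,x_2,x_3)$. *)

theory Defs
  imports "HOL-Probability.Probability" "Graph_Theory.Graph_Theory"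
begin

section \<open>Jointly Gaussian variables\<close>

text \<open>Constants count as Gaussian (variance zero), so singular covariance matrices are allowed.\<close>

definition gaussian_var :: "'a measure \<Rightarrow> ('a \<Rightarrow> real) \<Rightarrow> bool" where
  "gaussian_var M X \<longleftrightarrow> X \<in> borel_measurable M \<and>
     ((\<exists>\<mu> \<sigma>. \<sigma> > 0 \<and> distributed M lborel X (normal_density \<mu> \<sigma>)) \<or>
      (\<exists>\<mu>. AE \<omega> in M. X \<omega> = \<mu>))"

definition jointly_gaussian :: "'a measure \<Rightarrow> 'i set \<Rightarrow> ('i \<Rightarrow> 'a \<Rightarrow> real) \<Rightarrow> bool" where
  "jointly_gaussian M I X \<longleftrightarrow> finite I \<and> (\<forall>i\<in>I. X i \<in> borel_measurable M) \<and>
     (\<forall>c :: 'i \<Rightarrow> real. gaussian_var M (\<lambda>\<omega>. \<Sum>i\<in>I. c i * X i \<omega>))"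


section \<open>Conditional independence\<close>

text \<open>The conditional counterparts of \<^const>\<open>prob_space.indep_sets\<close> and
  \<^const>\<open>prob_space.indep_vars\<close>: conditional probabilities given the sub-sigma-algebra \<open>G\<close>
  are conditional expectations of indicator functions.\<close>

definition cond_indep_sets ::
    "'a measure \<Rightarrow> 'a measure \<Rightarrow> ('i \<Rightarrow> 'a set set) \<Rightarrow> 'i set \<Rightarrow> bool" where
  "cond_indep_sets M G F I \<longleftrightarrow> (\<forall>i\<in>I. F i \<subseteq> sets M) \<and>
     (\<forall>J\<subseteq>I. J \<noteq> {} \<longrightarrow> finite J \<longrightarrow> (\<forall>A\<in>Pi J F.
        AE \<omega> in M. real_cond_exp M G (indicator (\<Inter>j\<in>J. A j)) \<omega> =
          (\<Prod>j\<in>J. real_cond_exp M G (indicator (A j)) \<omega>)))"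

definition cond_indep_vars ::
    "'a measure \<Rightarrow> 'a measure \<Rightarrow> ('i \<Rightarrow> 'b measure) \<Rightarrow> ('i \<Rightarrow> 'a \<Rightarrow> 'b) \<Rightarrow> 'i set \<Rightarrow> bool" where
  "cond_indep_vars M G M' X I \<longleftrightarrow> (\<forall>i\<in>I. X i \<in> measurable M (M' i)) \<and>
     cond_indep_sets M G (\<lambda>i. {X i -` A \<inter> space M | A. A \<in> sets (M' i)}) I"


section \<open>Undirected trees\<close>

text \<open>An undirected graph is a symmetric digraph, in which traversing an edge back and forth is a
  \<^const>\<open>pre_digraph.cycle\<close> of length 2. Hence only cycles of length at least 3 are excluded, and the
  library's \<^const>\<open>tree\<close>, which forbids all directed cycles, is not applicable.\<close>

definition undirected_tree :: "'v pair_pre_digraph \<Rightarrow> bool" where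
  "undirected_tree T \<longleftrightarrow> pair_graph T \<and> Digraph_Component.connected (with_proj T) \<and>
     \<not> (\<exists>p. pre_digraph.cycle (with_proj T) p \<and> length p \<ge> 3)"

text \<open>By symmetry the strong components are the connected components.\<close>

definition components_without :: "'v pair_pre_digraph \<Rightarrow> 'v \<Rightarrow> 'v set set" where
  "components_without T v = pre_digraph.sccs_verts (pre_digraph.del_vert (with_proj T) v)"


section \<open>Gauss-Markov trees\<close>

definition gauss_markov_tree ::
    "'a measure \<Rightarrow> 'v pair_pre_digraph \<Rightarrow> ('v \<Rightarrow> 'a \<Rightarrow> real) \<Rightarrow> bool" where
  "gauss_markov_tree M T Y \<longleftrightarrow> prob_space M \<and> undirected_tree T \<and> jointly_gaussian M (pverts T) Y \<and>
     (\<forall>v\<in>pverts T. cond_indep_vars M (vimage_algebra (space M) (Y v) borel)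
        (\<lambda>C. PiM C (\<lambda>_. borel)) (\<lambda>C \<omega>. \<lambda>u\<in>C. Y u \<omega>) (components_without T v))"

text \<open>The tree may live on a probability space different from that of \<open>X\<close>. Being a Gauss-Markov tree
  depends only on the joint law of the variables, so vertices in \<^typ>\<open>nat\<close> and measures on
  \<^typ>\<open>nat \<Rightarrow> real\<close> (which include all joint laws of real variables indexed by a finite set of
  naturals) cover the general case.\<close>

definition embeddable_in_gauss_markov_tree ::
    "'a measure \<Rightarrow> 'i set \<Rightarrow> ('i \<Rightarrow> 'a \<Rightarrow> real) \<Rightarrow> bool" where
  "embeddable_in_gauss_markov_tree M I X \<longleftrightarrow>
     (\<exists>(N :: (nat \<Rightarrow> real) measure) (T :: nat pair_pre_digraph) Y f.
        gauss_markov_tree N T Y \<and> inj_on f I \<and> f ` I \<subseteq> pverts T \<and>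
        distr M (PiM I (\<lambda>_. borel)) (\<lambda>\<omega>. \<lambda>i\<in>I. X i \<omega>) =
        distr N (PiM I (\<lambda>_. borel)) (\<lambda>\<omega>. \<lambda>i\<in>I. Y (f i) \<omega>))"


section \<open>Conditional expectation given two variables\<close>

definition cond_exp_given2 ::
    "'a measure \<Rightarrow> ('a \<Rightarrow> real) \<Rightarrow> ('a \<Rightarrow> real) \<Rightarrow> ('a \<Rightarrow> real) \<Rightarrow> 'a \<Rightarrow> real" where
  "cond_exp_given2 M Z X Y =
     real_cond_exp M (vimage_algebra (space M) (\<lambda>\<omega>. (X \<omega>, Y \<omega>)) borel) Z"

end

theory Submission
  imports Defs
begin

text \<open>Let \<open>s i j\<close> be the covariances. The regression coefficients of \<open>x\<^sub>3\<close> on \<open>x\<^sub>1\<close>, \<open>x\<^sub>2\<close> are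
  proportional to \<open>s 1 3 * s 2 2 - s 1 2 * s 2 3\<close> and \<open>s 2 3 * s 1 1 - s 1 2 * s 1 3\<close>. If the
  conclusion fails for all three choices of the regressed variable, these sign conditions together
  with Cauchy-Schwarz yield numbers \<open>c i\<close> with \<open>s i j = c i * c j\<close> for \<open>i \<noteq> j\<close> and
  \<open>(c i)\<^sup>2 \<le> s i i\<close>. Then the \<open>x\<^sub>i\<close> have the joint law of the variables \<open>c i * z\<^sub>0 + d i * z\<^sub>i\<close>
  with independent standard normals \<open>z\<^sub>0, \<dots>, z\<^sub>3\<close>, and these form the leaves of a Gauss-Markov star
  with hidden centre \<open>z\<^sub>0\<close>. Equality of
  the joint laws follows from equality of the laws of all linear combinations (Cramer-Wold).\<close>

section \<open>Covariances of star type\<close>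

text \<open>Singular covariance matrices shape the proof: there may be no joint density, and
  regression coefficients need be neither unique nor obtainable by division. Hence the regression
  equations are kept multiplied by the Gram determinant, which yields the sign conditions even when
  it vanishes; every centred Gaussian law is written as the image of the standard normal law under
  multiplication by some \<open>\<sigma> \<ge> 0\<close>; and laws are compared through
  characteristic functions. The existence of regression coefficients is never proved: the negated
  conclusion provides them, one pair for each permutation. If no covariance vanishes,
  \<open>c1 * c2 = s12\<close>, \<open>c1 * c3 = s13\<close>, \<open>c2 * c3 = s23\<close> force
  \<open>c1^2 = s12 * s13 / s23\<close>, and the bound \<open>c1^2 \<le> v1\<close> then says that
  \<open>s23 * v1 - s12 * s13\<close> does not have the sign opposite to \<open>s23\<close>;
  likewise for the other two. This is how sign conditions on regression numerators turn into room
  for the noise variances. A chain needs no tree of its own: it is a star whose middle variable is a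
  multiple of the hub, with zero noise.\<close>

lemma star_covariance:
  fixes v1 v2 v3 s12 s13 s23 :: real
  assumes v: "v1 \<ge> 0" "v2 \<ge> 0" "v3 \<ge> 0"
    and cs: "s12\<^sup>2 \<le> v1 * v2" "s13\<^sup>2 \<le> v1 * v3" "s23\<^sup>2 \<le> v2 * v3"
    and pos: "(s13 * v2 - s12 * s23) * (s23 * v1 - s12 * s13) * s12 \<ge> 0"
      "(s12 * v3 - s13 * s23) * (s23 * v1 - s12 * s13) * s13 \<ge> 0"
      "(s12 * v3 - s13 * s23) * (s13 * v2 - s12 * s23) * s23 \<ge> 0"
  obtains c1 c2 c3 where "c1 * c2 = s12" "c1 * c3 = s13" "c2 * c3 = s23"
    "c1\<^sup>2 \<le> v1" "c2\<^sup>2 \<le> v2" "c3\<^sup>2 \<le> v3"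
proof -
  \<comment> \<open>The equation \<open>q * y = p * r\<close> makes the outer two variables
    uncorrelated once the middle one, of variance \<open>y\<close>, is regressed out. The middle
    variable then serves as hub, so \<open>b = sqrt y\<close>, and the other two numbers follow by
    division; their bounds are Cauchy-Schwarz.\<close>
  have chain: "\<exists>a b c. a * b = p \<and> a * c = q \<and> b * c = r \<and> a\<^sup>2 \<le> x \<and> b\<^sup>2 \<le> y \<and> c\<^sup>2 \<le> z"
    if h: "x \<ge> 0" "y \<ge> 0" "z \<ge> 0" "p\<^sup>2 \<le> x * y" "q\<^sup>2 \<le> x * z" "r\<^sup>2 \<le> y * z" "q * y = p * r"
    for p q r x y z :: real
  proof (cases "y = 0")
    case True
    then have "p = 0" "r = 0" using h by auto
    \<comment> \<open>A degenerate middle variable has \<open>p = r = 0\<close>, so only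
      \<open>q\<close> is left to factor. The first variable takes over as hub, with
      \<open>a = sqrt x\<close>, unless it is degenerate too.\<close>
    show ?thesis
    proof (cases "x = 0")
      case True
      with h have "q = 0" by auto
      then show ?thesis using \<open>p = 0\<close> \<open>r = 0\<close> h by (intro exI[of _ 0]) auto
    next
      case False
      then have "q\<^sup>2 / x \<le> z" using h by (simp add: field_simps)
      then show ?thesis using \<open>p = 0\<close> \<open>r = 0\<close> h False
        by (intro exI[of _ "sqrt x"] exI[of _ 0] exI[of _ "q / sqrt x"])
          (auto simp: power_divide)
    qed
  next
    case False
    then have y: "y > 0" using h by auto
    have "p\<^sup>2 / y \<le> x" "r\<^sup>2 / y \<le> z" using h y by (auto simp: field_simps)
    moreover have "p * r / y = q" using h y by (simp add: field_simps)
    ultimately show ?thesis using y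
      by (intro exI[of _ "p / sqrt y"] exI[of _ "sqrt y"] exI[of _ "r / sqrt y"])
        (auto simp: power_divide)
  qed
  \<comment> \<open>If some \<open>Pi\<close> vanishes, the covariance is that of a chain. Otherwise \<open>P1 * s23\<close>, \<open>P2 * s13\<close>,
    \<open>P3 * s12\<close> have a common sign, which Cauchy-Schwarz forces to be positive.\<close>
  define P1 where "P1 = s23 * v1 - s12 * s13"
  define P2 where "P2 = s13 * v2 - s12 * s23"
  define P3 where "P3 = s12 * v3 - s13 * s23"
  consider "P1 = 0" | "P2 = 0" | "P3 = 0" | "P1 \<noteq> 0" "P2 \<noteq> 0" "P3 \<noteq> 0" by blast
  then have "\<exists>c1 c2 c3. c1 * c2 = s12 \<and> c1 * c3 = s13 \<and> c2 * c3 = s23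
      \<and> c1\<^sup>2 \<le> v1 \<and> c2\<^sup>2 \<le> v2 \<and> c3\<^sup>2 \<le> v3"
  proof cases
    case 1
    \<comment> \<open>In each of the three chain cases the arguments are ordered so that the
      variable whose index labels the vanishing \<open>Pi\<close> stands in the middle.\<close>
    from chain[of v2 v1 v3 s12 s23 s13] 1 v cs show ?thesis
      unfolding P1_def by (simp add: mult.commute) (metis mult.commute)
  next
    case 2
    from chain[of v1 v2 v3 s12 s13 s23] 2 v cs show ?thesis
      unfolding P2_def by simp
  next
    case 3
    from chain[of v1 v3 v2 s13 s12 s23] 3 v cs show ?thesis
      unfolding P3_def by (simp add: mult.commute) (metis mult.commute)
  next
    case 4
    have pos': "P2 * P1 * s12 \<ge> 0" "P3 * P1 * s13 \<ge> 0" "P3 * P2 * s23 \<ge> 0"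
      using pos unfolding P1_def P2_def P3_def by auto
    \<comment> \<open>A vanishing covariance would turn one of the sign conditions into minus a
      square times a variance, and that is strictly negative because no \<open>Pi\<close>
      vanishes.\<close>
    have nz: "s12 \<noteq> 0" "s13 \<noteq> 0" "s23 \<noteq> 0"
    proof -
      show "s12 \<noteq> 0"
      proof
        assume "s12 = 0"
        then have e: "P1 = s23 * v1" "P3 = - s13 * s23" by (auto simp: P1_def P3_def)
        then have "P3 * P1 * s13 = - ((s13 * s23)\<^sup>2 * v1)"
          by (simp add: power2_eq_square)
        moreover have "(s13 * s23)\<^sup>2 * v1 > 0"
          using 4 v e by auto
        ultimately show False using pos' by linarith
      qed
      show "s13 \<noteq> 0"
      proof
        assume "s13 = 0"
        then have e: "P1 = s23 * v1" "P2 = - s12 * s23" by (auto simp: P1_def P2_def)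
        then have "P2 * P1 * s12 = - ((s12 * s23)\<^sup>2 * v1)"
          by (simp add: power2_eq_square)
        moreover have "(s12 * s23)\<^sup>2 * v1 > 0"
          using 4 v e by auto
        ultimately show False using pos' by linarith
      qed
      show "s23 \<noteq> 0"
      proof
        assume "s23 = 0"
        then have e: "P1 = - s12 * s13" "P2 = s13 * v2" by (auto simp: P1_def P2_def)
        then have "P2 * P1 * s12 = - ((s12 * s13)\<^sup>2 * v2)"
          by (simp add: power2_eq_square)
        moreover have "(s12 * s13)\<^sup>2 * v2 > 0"
          using 4 v e by auto
        ultimately show False using pos' by linarith
      qed
    qed
    have pp: "P2 * P1 * s12 > 0" "P3 * P1 * s13 > 0" "P3 * P2 * s23 > 0"
      using pos' nz 4 by (auto simp: less_le)
    \<comment> \<open>Each \<open>Pi\<close> occurs in exactly two of the three conditions, so their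
      product is a square times \<open>s12 * s13 * s23\<close>.\<close>
    have prod: "s12 * s13 * s23 > 0"
    proof -
      have "(P2 * P1 * s12) * (P3 * P1 * s13) * (P3 * P2 * s23) = (P1 * P2 * P3)\<^sup>2 * (s12 * s13 * s23)"
        by (simp add: power2_eq_square)
      moreover have "(P2 * P1 * s12) * (P3 * P1 * s13) * (P3 * P2 * s23) > 0"
        by (intro mult_pos_pos pp)
      ultimately show ?thesis using 4 by (metis zero_less_mult_pos zero_less_power2 mult_eq_0_iff)
    qed
    \<comment> \<open>Multiplying a condition by the positive \<open>s12 * s13 * s23\<close> squares
      its own covariance and pairs each remaining \<open>Pi\<close> with the covariance of the other
      two variables.\<close>
    have same_sign: "(P1 * s23) * (P2 * s13) > 0" "(P1 * s23) * (P3 * s12) > 0"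
    proof -
      have "(P2 * P1 * s12) * (s12 * s13 * s23) = s12\<^sup>2 * ((P1 * s23) * (P2 * s13))"
        "(P3 * P1 * s13) * (s12 * s13 * s23) = s13\<^sup>2 * ((P1 * s23) * (P3 * s12))"
        by (simp_all add: power2_eq_square)
      moreover have "(P2 * P1 * s12) * (s12 * s13 * s23) > 0" "(P3 * P1 * s13) * (s12 * s13 * s23) > 0"
        by (intro mult_pos_pos pp prod)+
      moreover have "s12\<^sup>2 > 0" "s13\<^sup>2 > 0" using nz by auto
      ultimately show "(P1 * s23) * (P2 * s13) > 0" "(P1 * s23) * (P3 * s12) > 0"
        by (metis zero_less_mult_pos)+
    qed
    have P: "P1 * s23 > 0" "P2 * s13 > 0" "P3 * s12 > 0"
    proof -
      have "P1 * s23 > 0"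
      proof (rule ccontr)
        assume "\<not> ?thesis"
        then have n1: "P1 * s23 < 0" using nz 4 by (simp add: less_le)
        have n2: "P2 * s13 < 0"
          using same_sign(1) zero_less_mult_iff[of "P1 * s23" "P2 * s13"] n1 by (meson less_asym)
        \<comment> \<open>Were the common sign negative, multiplying these two bounds would give
          \<open>v1 * v2 < s12^2\<close>, against Cauchy-Schwarz.\<close>
        have "s23\<^sup>2 * v1 < s12 * s13 * s23" "s13\<^sup>2 * v2 < s12 * s13 * s23"
          using n1 n2 by (auto simp: P1_def P2_def algebra_simps power2_eq_square)
        moreover have "0 \<le> s23\<^sup>2 * v1" "0 \<le> s13\<^sup>2 * v2" using v by auto
        ultimately have "(s23\<^sup>2 * v1) * (s13\<^sup>2 * v2) < (s12 * s13 * s23) * (s12 * s13 * s23)"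
          by (rule mult_strict_mono')
        then have "(s13 * s23)\<^sup>2 * (v1 * v2) < (s13 * s23)\<^sup>2 * s12\<^sup>2"
          by (simp add: power2_eq_square mult_ac)
        then show False using cs(1) by (simp add: mult_less_cancel_left)
      qed
      then show "P1 * s23 > 0" "P2 * s13 > 0" "P3 * s12 > 0"
        using same_sign by (metis zero_less_mult_pos)+
    qed
    \<comment> \<open>Forced up to sign, since
      \<open>c1^2 = (c1 * c2) * (c1 * c3) / (c2 * c3)\<close>. Taking the positive root is a choice;
      \<open>c2\<close> and \<open>c3\<close> then carry the signs of \<open>s12\<close> and
      \<open>s13\<close>.\<close>
    define c1 where "c1 = sqrt (s12 * s13 / s23)"
    have r: "s12 * s13 / s23 > 0"
      using prod by (auto simp: zero_less_mult_iff zero_less_divide_iff)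
    have c1: "c1\<^sup>2 = s12 * s13 / s23" "c1 \<noteq> 0" unfolding c1_def using r by auto
    have "s12 * s13 / s23 \<le> v1"
      using P(1) nz unfolding P1_def by (cases "s23 > 0") (auto simp: field_simps zero_less_mult_iff)
    moreover have "s12\<^sup>2 / c1\<^sup>2 \<le> v2"
    proof -
      have "s12\<^sup>2 / c1\<^sup>2 = s12 * s23 / s13" unfolding c1(1) using nz by (simp add: field_simps power2_eq_square)
      also have "\<dots> \<le> v2"
        using P(2) nz unfolding P2_def by (cases "s13 > 0") (auto simp: field_simps zero_less_mult_iff)
      finally show ?thesis .
    qed
    moreover have "s13\<^sup>2 / c1\<^sup>2 \<le> v3"
    proof -
      have "s13\<^sup>2 / c1\<^sup>2 = s13 * s23 / s12" unfolding c1(1) using nz by (simp add: field_simps power2_eq_square)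
      also have "\<dots> \<le> v3"
        using P(3) nz unfolding P3_def by (cases "s12 > 0") (auto simp: field_simps zero_less_mult_iff)
      finally show ?thesis .
    qed
    moreover have "s12 / c1 * (s13 / c1) = s23"
    proof -
      have "s12 / c1 * (s13 / c1) = s12 * s13 / c1\<^sup>2" by (simp add: power2_eq_square)
      then show ?thesis using nz by (simp add: c1)
    qed
    ultimately show ?thesis using c1
      by (intro exI[of _ c1] exI[of _ "s12 / c1"] exI[of _ "s13 / c1"]) (auto simp: power_divide)
  qed
  then show ?thesis using that by blast
qed

section \<open>Uniqueness of joint laws\<close>

text \<open>Levy uniqueness for finite weighted measures: dividing the weight by its total mass
  \<open>m\<close> gives a probability measure under which the variable has the given integral over
  \<open>m\<close> as its characteristic function. Weights are allowed so that already treated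
  coordinates can be absorbed into them.\<close>

lemma integral_iexp_determines:
  fixes u :: "'a \<Rightarrow> real" and u' :: "'b \<Rightarrow> real"
  assumes u: "integrable M u" "\<And>x. 0 \<le> u x" and u': "integrable N u'" "\<And>x. 0 \<le> u' x"
    and X[measurable]: "X \<in> borel_measurable M" "Y \<in> borel_measurable N"
    and eq: "\<And>s. (CLINT x|M. u x * iexp (s * X x)) = (CLINT x|N. u' x * iexp (s * Y x))"
    and B[measurable]: "B \<in> sets borel"
  shows "(LINT x|M. u x * indicator B (X x)) = (LINT x|N. u' x * indicator B (Y x))"
proof -
  define m where "m = integral\<^sup>L M u"
  \<comment> \<open>At \<open>s = 0\<close> the exponential is 1, so both weights have the same
    mass; mass zero is split off because it cannot be normalised.\<close>
  have m': "m = integral\<^sup>L N u'" unfolding m_def using eq[of 0] by simp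
  have m_nonneg: "m \<ge> 0" unfolding m_def using u(2) by simp
  show ?thesis
  proof (cases "m = 0")
    case True
    then have "integral\<^sup>L M u = 0" "integral\<^sup>L N u' = 0" using m' by (simp_all add: m_def)
    then have "AE x in M. u x = 0" "AE x in N. u' x = 0"
      using u u' by (simp_all add: integral_nonneg_eq_0_iff_AE)
    then have "(LINT x|M. u x * indicator B (X x)) = 0" "(LINT x|N. u' x * indicator B (Y x)) = 0"
      by (auto intro!: integral_eq_zero_AE)
    then show ?thesis by simp
  next
    case False
    with m_nonneg have m: "m > 0" by simp
    \<comment> \<open>Stated for a fresh space so that it applies on both sides, whose sample types
      differ.\<close>
    have law: "real_distribution (distr (density L (\<lambda>x. ennreal (v x / m))) borel Z)
        \<and> char (distr (density L (\<lambda>x. ennreal (v x / m))) borel Z)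
            = (\<lambda>s. (CLINT x|L. v x * iexp (s * Z x)) / m)
        \<and> measure (distr (density L (\<lambda>x. ennreal (v x / m))) borel Z) B
            = (LINT x|L. v x * indicator B (Z x)) / m"
      if v: "integrable L v" "\<And>x. 0 \<le> v x" "integral\<^sup>L L v = m" and Z[measurable]: "Z \<in> borel_measurable L"
      for L :: "'c measure" and v Z
    proof (intro conjI)
      have [measurable]: "v \<in> borel_measurable L" using v(1) by auto
      have "(\<integral>\<^sup>+ x. ennreal (v x / m) \<partial>L) = ennreal (LINT x|L. v x / m)"
        using v m by (intro nn_integral_eq_integral) auto
      also have "\<dots> = 1" using v m by simp
      finally have P: "prob_space (density L (\<lambda>x. ennreal (v x / m)))"
        by (intro prob_spaceI) (simp add: emeasure_density cong: nn_integral_cong)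
      then interpret P: prob_space "density L (\<lambda>x. ennreal (v x / m))" .
      show "real_distribution (distr (density L (\<lambda>x. ennreal (v x / m))) borel Z)"
        by (rule P.real_distribution_distr) simp
      show "char (distr (density L (\<lambda>x. ennreal (v x / m))) borel Z)
            = (\<lambda>s. (CLINT x|L. v x * iexp (s * Z x)) / m)"
      proof
        fix s
        have "char (distr (density L (\<lambda>x. ennreal (v x / m))) borel Z) s
            = (CLINT x|L. (v x / m) *\<^sub>R iexp (s * Z x))"
          unfolding char_def using v m
          by (simp add: integral_distr integral_density)
        also have "\<dots> = (CLINT x|L. v x * iexp (s * Z x) / m)"
          by (simp add: scaleR_conv_of_real)
        finally show "char (distr (density L (\<lambda>x. ennreal (v x / m))) borel Z) s
            = (CLINT x|L. v x * iexp (s * Z x)) / m" by simp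
      qed
      have "measure (distr (density L (\<lambda>x. ennreal (v x / m))) borel Z) B
          = (LINT x|density L (\<lambda>x. ennreal (v x / m)). indicator B (Z x))"
        by (subst integral_distr[symmetric, where N=borel]) auto
      also have "\<dots> = (LINT x|L. (v x / m) *\<^sub>R indicator B (Z x))"
        using v m by (subst integral_density) auto
      finally show "measure (distr (density L (\<lambda>x. ennreal (v x / m))) borel Z) B
            = (LINT x|L. v x * indicator B (Z x)) / m"
        by (simp add: )
    qed
    have 1: "integral\<^sup>L M u = m" by (simp add: m_def)
    have 2: "integral\<^sup>L N u' = m" by (simp add: m')
    note L1 = law[OF u 1 X(1)] and L2 = law[OF u' 2 X(2)]
    have "distr (density M (\<lambda>x. ennreal (u x / m))) borel X
        = distr (density N (\<lambda>x. ennreal (u' x / m))) borel Y"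
      using L1 L2 eq by (intro Levy_uniqueness) auto
    then have "(LINT x|M. u x * indicator B (X x)) / m = (LINT x|N. u' x * indicator B (Y x)) / m"
      using L1 L2 by metis
    then show ?thesis using m by simp
  qed
qed

text \<open>The nonnegative weights \<open>1 + cos \<theta>\<close> and \<open>1 + sin \<theta>\<close> turn the one-dimensional uniqueness
  theorem into a statement about the complex weight \<open>iexp \<theta>\<close>.\<close>

lemma integral_iexp_iexp_determines:
  fixes u :: "'a \<Rightarrow> real" and u' :: "'b \<Rightarrow> real"
  assumes u: "integrable M u" "\<And>x. 0 \<le> u x" and u': "integrable N u'" "\<And>x. 0 \<le> u' x"
    and X[measurable]: "X \<in> borel_measurable M" "Y \<in> borel_measurable N"
    and \<theta>[measurable]: "\<theta> \<in> borel_measurable M" "\<theta>' \<in> borel_measurable N"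
    and eq: "\<And>a s. (CLINT x|M. u x * iexp (a * \<theta> x + s * X x))
        = (CLINT x|N. u' x * iexp (a * \<theta>' x + s * Y x))"
    and B[measurable]: "B \<in> sets borel"
  shows "(CLINT x|M. u x * indicator B (X x) * iexp (\<theta> x))
    = (CLINT x|N. u' x * indicator B (Y x) * iexp (\<theta>' x))"
proof -
  have bounded: "integrable L (\<lambda>x. v x * f x)"
    if "integrable L v" "f \<in> borel_measurable L" "\<And>x. \<bar>f x\<bar> \<le> 2" for L :: "'c measure" and v f :: "'c \<Rightarrow> real"
  proof (rule Bochner_Integration.integrable_bound[where f="\<lambda>x. 2 * v x"])
    show "AE x in L. norm (v x * f x) \<le> norm (2 * v x)"
      using mult_right_mono[OF that(3) abs_ge_zero[of "v x" for x]] by (simp add: abs_mult mult.commute)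
  qed (use that in auto)
  have cbounded: "integrable L (\<lambda>x. v x * f x)"
    if "integrable L v" "f \<in> borel_measurable L" "\<And>x. norm (f x) \<le> 2"
    for L :: "'c measure" and v :: "'c \<Rightarrow> real" and f :: "'c \<Rightarrow> complex"
  proof (rule Bochner_Integration.integrable_bound[where f="\<lambda>x. 2 * v x"])
    show "AE x in L. norm (v x * f x) \<le> norm (2 * v x)"
      using mult_right_mono[OF that(3) abs_ge_zero[of "v x" for x]] by (simp add: norm_mult abs_mult mult.commute)
  qed (use that in auto)
  \<comment> \<open>By Euler's formula the trigonometric weights reduce to exponential integrals
    with \<open>a\<close> equal to 0, 1 and -1. This is what the quantification over
    \<open>a\<close> in the hypothesis provides.\<close>
  have expand: "(CLINT x|L. (v x * (1 + cos (\<phi> x))) * iexp (s * Z x))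
        = (CLINT x|L. v x * iexp (0 * \<phi> x + s * Z x))
        + (CLINT x|L. v x * iexp (1 * \<phi> x + s * Z x)) / 2 + (CLINT x|L. v x * iexp ((-1) * \<phi> x + s * Z x)) / 2
      \<and> (CLINT x|L. (v x * (1 + sin (\<phi> x))) * iexp (s * Z x))
        = (CLINT x|L. v x * iexp (0 * \<phi> x + s * Z x))
        + (CLINT x|L. v x * iexp (1 * \<phi> x + s * Z x)) / (2 * \<i>) - (CLINT x|L. v x * iexp ((-1) * \<phi> x + s * Z x)) / (2 * \<i>)"
    if v: "integrable L v" and [measurable]: "\<phi> \<in> borel_measurable L" "Z \<in> borel_measurable L"
    for L :: "'c measure" and v \<phi> Z :: "'c \<Rightarrow> real" and s
  proof -
    define F where "F = (\<lambda>a x. v x * iexp (a * \<phi> x + s * Z x))"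
    have i: "integrable L (F a)" for a
      unfolding F_def by (rule cbounded[OF v]) (auto simp: norm_exp_i_times)
    have ce: "complex_of_real (cos t) = (iexp t + iexp (- t)) / 2"
      and se: "complex_of_real (sin t) = (iexp t - iexp (- t)) / (2 * \<i>)" for t
      unfolding cis_conv_exp[symmetric] by (simp_all add: complex_eq_iff Re_divide Im_divide)
    have e: "iexp (0 * \<phi> x + s * Z x) = iexp (s * Z x)"
      "iexp (1 * \<phi> x + s * Z x) = iexp (\<phi> x) * iexp (s * Z x)"
      "iexp ((-1) * \<phi> x + s * Z x) = iexp (- \<phi> x) * iexp (s * Z x)" for x
      by (simp_all add: exp_add[symmetric] algebra_simps)
    have c: "(v x * (1 + cos (\<phi> x))) * iexp (s * Z x)
        = v x * iexp (0 * \<phi> x + s * Z x) + v x * iexp (1 * \<phi> x + s * Z x) / 2 + v x * iexp ((-1) * \<phi> x + s * Z x) / 2" for x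
    proof -
      have *: "complex_of_real (v x * (1 + cos (\<phi> x))) = v x * (1 + (iexp (\<phi> x) + iexp (- \<phi> x)) / 2)"
        by (simp only: of_real_mult of_real_add of_real_1 ce)
      have alg: "V * (1 + (E + E') / w) * F = V * F + V * (E * F) / w + V * (E' * F) / w" for V E E' F w :: complex
        by (simp add: divide_inverse algebra_simps)
      show ?thesis unfolding e * by (rule alg)
    qed
    have d: "(v x * (1 + sin (\<phi> x))) * iexp (s * Z x)
        = v x * iexp (0 * \<phi> x + s * Z x) + v x * iexp (1 * \<phi> x + s * Z x) / (2 * \<i>) - v x * iexp ((-1) * \<phi> x + s * Z x) / (2*\<i>)" for x
    proof -
      have *: "complex_of_real (v x * (1 + sin (\<phi> x))) = v x * (1 + (iexp (\<phi> x) - iexp (- \<phi> x)) / (2 * \<i>))"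
        by (simp only: of_real_mult of_real_add of_real_1 se)
      have alg: "V * (1 + (E - E') / w) * F = V * F + V * (E * F) / w - V * (E' * F) / w" for V E E' F w :: complex
        by (simp add: divide_inverse algebra_simps)
      show ?thesis unfolding e * by (rule alg)
    qed
    have "(CLINT x|L. (v x * (1 + cos (\<phi> x))) * iexp (s * Z x)) = (CLINT x|L. F 0 x + F 1 x / 2 + F (-1) x / 2)"
      by (simp only: c F_def)
    also have "\<dots> = integral\<^sup>L L (F 0) + integral\<^sup>L L (F 1) / 2 + integral\<^sup>L L (F (-1)) / 2"
      using i by simp
    finally have C: "(CLINT x|L. (v x * (1 + cos (\<phi> x))) * iexp (s * Z x))
      = integral\<^sup>L L (F 0) + integral\<^sup>L L (F 1) / 2 + integral\<^sup>L L (F (-1)) / 2" .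
    have "(CLINT x|L. (v x * (1 + sin (\<phi> x))) * iexp (s * Z x))
      = (CLINT x|L. F 0 x + F 1 x / (2 * \<i>) - F (-1) x / (2 * \<i>))"
      by (simp only: d F_def)
    also have "\<dots> = integral\<^sup>L L (F 0) + integral\<^sup>L L (F 1) / (2 * \<i>) - integral\<^sup>L L (F (-1)) / (2 * \<i>)"
      using i by simp
    finally have "(CLINT x|L. (v x * (1 + sin (\<phi> x))) * iexp (s * Z x))
      = integral\<^sup>L L (F 0) + integral\<^sup>L L (F 1) / (2 * \<i>) - integral\<^sup>L L (F (-1)) / (2 * \<i>)" .
    with C show ?thesis unfolding F_def by (rule conjI)
  qed
  have 0: "(LINT x|M. u x * indicator B (X x)) = (LINT x|N. u' x * indicator B (Y x))"
    using eq[of 0] by (intro integral_iexp_determines u u' X B) simp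
  have w: "1 + cos (t::real) \<ge> 0" "1 + sin t \<ge> 0" "\<bar>1 + cos t\<bar> \<le> 2" "\<bar>1 + sin t\<bar> \<le> 2" for t
    using cos_ge_minus_one[of t] sin_ge_minus_one[of t] cos_le_one[of t] sin_le_one[of t] by linarith+
  have C: "(LINT x|M. (u x * (1 + cos (\<theta> x))) * indicator B (X x))
      = (LINT x|N. (u' x * (1 + cos (\<theta>' x))) * indicator B (Y x))"
  proof (rule integral_iexp_determines[OF _ _ _ _ X])
    show "(CLINT x|M. (u x * (1 + cos (\<theta> x))) * iexp (s * X x))
      = (CLINT x|N. (u' x * (1 + cos (\<theta>' x))) * iexp (s * Y x))" for s
      by (simp only: conjunct1[OF expand[OF u(1) \<theta>(1) X(1)]] conjunct1[OF expand[OF u'(1) \<theta>(2) X(2)]] eq)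
  qed (use u u' w in \<open>auto intro!: bounded B\<close>)
  have S: "(LINT x|M. (u x * (1 + sin (\<theta> x))) * indicator B (X x))
      = (LINT x|N. (u' x * (1 + sin (\<theta>' x))) * indicator B (Y x))"
  proof (rule integral_iexp_determines[OF _ _ _ _ X])
    show "(CLINT x|M. (u x * (1 + sin (\<theta> x))) * iexp (s * X x))
      = (CLINT x|N. (u' x * (1 + sin (\<theta>' x))) * iexp (s * Y x))" for s
      by (simp only: conjunct2[OF expand[OF u(1) \<theta>(1) X(1)]] conjunct2[OF expand[OF u'(1) \<theta>(2) X(2)]] eq)
  qed (use u u' w in \<open>auto intro!: bounded B\<close>)
  \<comment> \<open>Subtracting the integral with the plain weight removes the constant 1 that was
    added for nonnegativity; the cosine and sine integrals left over are the real and imaginary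
    parts.\<close>
  have parts: "(CLINT x|L. v x * indicator B (Z x) * iexp (\<phi> x))
      = complex_of_real ((LINT x|L. (v x * (1 + cos (\<phi> x))) * indicator B (Z x)) - (LINT x|L. v x * indicator B (Z x)))
      + \<i> * complex_of_real ((LINT x|L. (v x * (1 + sin (\<phi> x))) * indicator B (Z x)) - (LINT x|L. v x * indicator B (Z x)))"
    if v: "integrable L v" and [measurable]: "\<phi> \<in> borel_measurable L" "Z \<in> borel_measurable L"
    for L :: "'c measure" and v \<phi> Z :: "'c \<Rightarrow> real"
  proof -
    have i: "integrable L (\<lambda>x. v x * f (\<phi> x) * indicator B (Z x))"
      if [measurable]: "f \<in> borel_measurable borel" "\<And>t. \<bar>f t\<bar> \<le> 2" for f
      using bounded[OF v, of "\<lambda>x. f (\<phi> x) * indicator B (Z x)"] that(2)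
      by (auto simp: indicator_def mult.assoc)
    have split: "(LINT x|L. (v x * (1 + f (\<phi> x))) * indicator B (Z x))
        = (LINT x|L. v x * indicator B (Z x)) + (LINT x|L. v x * f (\<phi> x) * indicator B (Z x))"
      if [measurable]: "f \<in> borel_measurable borel" and "\<And>t. \<bar>f t\<bar> \<le> 2" for f
      using i[of f] i[of "\<lambda>_. 1"] that by (simp add: algebra_simps)
    have le2: "\<bar>cos t\<bar> \<le> 2" "\<bar>sin t\<bar> \<le> 2" for t :: real
      using abs_cos_le_one[of t] abs_sin_le_one[of t] by linarith+
    have trig: "cos \<in> borel_measurable (borel :: real measure)" "sin \<in> borel_measurable (borel :: real measure)"
      by simp_all
    have ic: "integrable L (\<lambda>x. v x * cos (\<phi> x) * indicator B (Z x))"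
      "integrable L (\<lambda>x. v x * sin (\<phi> x) * indicator B (Z x))"
      by (rule i, simp, rule le2)+
    have cos_part: "(LINT x|L. (v x * (1 + cos (\<phi> x))) * indicator B (Z x)) - (LINT x|L. v x * indicator B (Z x))
        = (LINT x|L. v x * cos (\<phi> x) * indicator B (Z x))"
      using split[OF trig(1) le2(1)] by linarith
    have sin_part: "(LINT x|L. (v x * (1 + sin (\<phi> x))) * indicator B (Z x)) - (LINT x|L. v x * indicator B (Z x))
        = (LINT x|L. v x * sin (\<phi> x) * indicator B (Z x))"
      using split[OF trig(2) le2(2)] by linarith
    have "(CLINT x|L. v x * indicator B (Z x) * iexp (\<phi> x))
        = (CLINT x|L. complex_of_real (v x * cos (\<phi> x) * indicator B (Z x))
            + \<i> * complex_of_real (v x * sin (\<phi> x) * indicator B (Z x)))"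
      by (intro Bochner_Integration.integral_cong refl)
        (auto simp: indicator_def cis_conv_exp[symmetric] complex_eq_iff)
    also have "\<dots> = complex_of_real (LINT x|L. v x * cos (\<phi> x) * indicator B (Z x))
            + \<i> * complex_of_real (LINT x|L. v x * sin (\<phi> x) * indicator B (Z x))"
      using ic by (subst Bochner_Integration.integral_add) (auto intro!: integrable_of_real simp del: of_real_mult)
    finally show ?thesis unfolding cos_part sin_part .
  qed
  show ?thesis
    by (simp only: parts[OF u(1) \<theta>(1) X(1)] parts[OF u'(1) \<theta>(2) X(2)] 0 C S)
qed

text \<open>Only one-dimensional uniqueness is used, one coordinate at a time. Equal laws of linear
  combinations give equal exponential integrals; exponentials are then exchanged for indicators
  coordinate by coordinate until boxes are measured.\<close>

lemma cramer_wold: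
  fixes X :: "'i \<Rightarrow> 'a \<Rightarrow> real" and Y :: "'i \<Rightarrow> 'b \<Rightarrow> real"
  assumes M: "prob_space M" and N: "prob_space N" and I: "finite I"
    and X: "\<And>i. i \<in> I \<Longrightarrow> X i \<in> borel_measurable M"
    and Y: "\<And>i. i \<in> I \<Longrightarrow> Y i \<in> borel_measurable N"
    and eq: "\<And>c. distr M borel (\<lambda>\<omega>. \<Sum>i\<in>I. c i * X i \<omega>) = distr N borel (\<lambda>\<omega>. \<Sum>i\<in>I. c i * Y i \<omega>)"
  shows "distr M (PiM I (\<lambda>_. borel)) (\<lambda>\<omega>. \<lambda>i\<in>I. X i \<omega>)
    = distr N (PiM I (\<lambda>_. borel)) (\<lambda>\<omega>. \<lambda>i\<in>I. Y i \<omega>)"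
proof -
  interpret M: prob_space M by (rule M)
  interpret N: prob_space N by (rule N)
  \<comment> \<open>Coordinates in \<open>J\<close> are tested by indicators, the others by an
    exponential. The case \<open>J = {}\<close> is the hypothesis and \<open>J = I\<close> the goal.
    In the induction step the indicators already present form the weight \<open>u\<close>,
    coordinate \<open>j\<close> is the variable, and the remaining linear form is the phase.\<close>
  have mixed: "(CLINT x|M. (\<Prod>j\<in>J. indicator (B j) (X j x) :: real) * iexp (\<Sum>k\<in>I-J. t k * X k x))
      = (CLINT x|N. (\<Prod>j\<in>J. indicator (B j) (Y j x) :: real) * iexp (\<Sum>k\<in>I-J. t k * Y k x))"
    if "finite J" "J \<subseteq> I" "\<And>j. j \<in> J \<Longrightarrow> B j \<in> sets borel" for J t B
    using that
  proof (induction J arbitrary: t rule: finite_induct)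
    case empty
    have [measurable]: "(\<lambda>\<omega>. \<Sum>i\<in>I. t i * X i \<omega>) \<in> borel_measurable M"
      "(\<lambda>\<omega>. \<Sum>i\<in>I. t i * Y i \<omega>) \<in> borel_measurable N"
      using X Y by (auto intro!: borel_measurable_sum borel_measurable_times)
    have "(CLINT x|distr M borel (\<lambda>\<omega>. \<Sum>i\<in>I. t i * X i \<omega>). iexp x)
        = (CLINT x|distr N borel (\<lambda>\<omega>. \<Sum>i\<in>I. t i * Y i \<omega>). iexp x)"
      by (simp only: eq)
    then show ?case by (simp add: integral_distr)
  next
    case (insert j J)
    have [measurable]: "X j \<in> borel_measurable M" "Y j \<in> borel_measurable N" "B j \<in> sets borel"
      using insert X Y by auto
    have prod_meas[measurable]: "(\<lambda>x. \<Prod>j\<in>J. indicator (B j) (X j x) :: real) \<in> borel_measurable M"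
      "(\<lambda>x. \<Prod>j\<in>J. indicator (B j) (Y j x) :: real) \<in> borel_measurable N"
      using insert X Y by (auto intro!: borel_measurable_prod borel_measurable_indicator')
    have [measurable]: "(\<lambda>x. \<Sum>k\<in>I - insert j J. t k * X k x) \<in> borel_measurable M"
      "(\<lambda>x. \<Sum>k\<in>I - insert j J. t k * Y k x) \<in> borel_measurable N"
      using X Y by (auto intro!: borel_measurable_sum borel_measurable_times)
    have prod_le: "(\<Prod>j\<in>J. indicator (B j) (f j) :: real) \<in> {0..1}" for f
      by (auto intro!: prod_nonneg prod_le_1 simp: indicator_def)
    have ins: "I - J = insert j (I - insert j J)" using insert by auto
    \<comment> \<open>Scaling the phase by \<open>a\<close> and adding \<open>s\<close> times
      coordinate \<open>j\<close> gives another linear form on \<open>I - J\<close>. The induction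
      hypothesis covers it because \<open>t\<close> is arbitrary there.\<close>
    have lin: "a * (\<Sum>k\<in>I - insert j J. t k * f k) + s * f j
        = (\<Sum>k\<in>I - J. ((\<lambda>k. a * t k)(j := s)) k * f k)" for a s and f :: "'i \<Rightarrow> real"
    proof -
      have "(\<Sum>k\<in>I - J. ((\<lambda>k. a * t k)(j := s)) k * f k)
          = s * f j + (\<Sum>k\<in>I - insert j J. ((\<lambda>k. a * t k)(j := s)) k * f k)"
        unfolding ins using I by (subst sum.insert) auto
      also have "(\<Sum>k\<in>I - insert j J. ((\<lambda>k. a * t k)(j := s)) k * f k) = (\<Sum>k\<in>I - insert j J. a * (t k * f k))"
        by (intro sum.cong) auto
      finally show ?thesis by (simp add: sum_distrib_left)
    qed
    have linX: "a * (\<Sum>k\<in>I - insert j J. t k * X k x) + s * X j x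
        = (\<Sum>k\<in>I - J. ((\<lambda>k. a * t k)(j := s)) k * X k x)" for a s x by (rule lin)
    have linY: "a * (\<Sum>k\<in>I - insert j J. t k * Y k x) + s * Y j x
        = (\<Sum>k\<in>I - J. ((\<lambda>k. a * t k)(j := s)) k * Y k x)" for a s x by (rule lin)
    have "(CLINT x|M. (\<Prod>j\<in>J. indicator (B j) (X j x) :: real) * indicator (B j) (X j x)
          * iexp (\<Sum>k\<in>I - insert j J. t k * X k x))
      = (CLINT x|N. (\<Prod>j\<in>J. indicator (B j) (Y j x) :: real) * indicator (B j) (Y j x)
          * iexp (\<Sum>k\<in>I - insert j J. t k * Y k x))"
    proof (rule integral_iexp_iexp_determines)
      show "integrable M (\<lambda>x. \<Prod>j\<in>J. indicator (B j) (X j x) :: real)"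
        using prod_le by (intro M.integrable_const_bound[where B=1]) auto
      show "integrable N (\<lambda>x. \<Prod>j\<in>J. indicator (B j) (Y j x) :: real)"
        using prod_le by (intro N.integrable_const_bound[where B=1]) auto
      show "(CLINT x|M. (\<Prod>j\<in>J. indicator (B j) (X j x) :: real)
            * iexp (a * (\<Sum>k\<in>I - insert j J. t k * X k x) + s * X j x))
        = (CLINT x|N. (\<Prod>j\<in>J. indicator (B j) (Y j x) :: real)
            * iexp (a * (\<Sum>k\<in>I - insert j J. t k * Y k x) + s * Y j x))" for a s
        unfolding linX linY
          by (rule insert.IH) (use insert.prems in auto)
    qed (use prod_le in auto)
    then show ?case using insert.hyps
      by (simp add: mult.commute of_real_indicator)
  qed
  have XI[measurable]: "(\<lambda>\<omega>. \<lambda>i\<in>I. X i \<omega>) \<in> measurable M (PiM I (\<lambda>_. borel))"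
    and YI[measurable]: "(\<lambda>\<omega>. \<lambda>i\<in>I. Y i \<omega>) \<in> measurable N (PiM I (\<lambda>_. borel))"
    using X Y by (auto intro: measurable_restrict)
  show ?thesis
  proof (rule measure_eqI_PiM_infinite[where I=I and M="\<lambda>_. borel"])
    show "finite_measure (distr M (PiM I (\<lambda>_. borel)) (\<lambda>\<omega>. \<lambda>i\<in>I. X i \<omega>))"
      by (rule M.finite_measure_distr) simp
    fix A J assume J: "finite J" "J \<subseteq> I" and "\<And>i. i \<in> J \<Longrightarrow> A i \<in> sets (borel :: real measure)"
    \<comment> \<open>Filling the missing coordinates with \<open>UNIV\<close> turns a cylinder over
      \<open>J\<close> into a box over all of \<open>I\<close>.\<close>
    define B where "B i = (if i \<in> J then A i else UNIV)" for i
    have B: "\<And>i. B i \<in> sets borel" and PB: "prod_emb I (\<lambda>_. borel) J (Pi\<^sub>E J A) = Pi\<^sub>E I B"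
      using \<open>\<And>i. i \<in> J \<Longrightarrow> A i \<in> sets borel\<close> J
      by (auto simp: B_def prod_emb_def PiE_iff space_PiM subset_iff split: if_splits)
    \<comment> \<open>The exponential of the empty sum is 1; it is written out only to match
      \<open>mixed\<close> at \<open>J = I\<close>.\<close>
    have *: "(CLINT x|L. (\<Prod>j\<in>I. indicator (B j) (Z j x) :: real) * iexp (\<Sum>k\<in>I-I. 0 * Z k x))
        = complex_of_real (measure (distr L (PiM I (\<lambda>_. borel)) (\<lambda>\<omega>. \<lambda>i\<in>I. Z i \<omega>)) (Pi\<^sub>E I B))"
      if [measurable]: "(\<lambda>\<omega>. \<lambda>i\<in>I. Z i \<omega>) \<in> measurable L (PiM I (\<lambda>_. borel))" for L :: "'c measure" and Z
    proof -
      have [measurable]: "Pi\<^sub>E I B \<in> sets (PiM I (\<lambda>_. borel))"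
        using B I by (intro sets_PiM_I_finite) auto
      have "(\<Prod>j\<in>I. indicator (B j) (Z j x) :: real) = indicator (Pi\<^sub>E I B) (\<lambda>i\<in>I. Z i x)" for x
        using I by (auto simp: indicator_def PiE_iff)
      then have "(CLINT x|L. (\<Prod>j\<in>I. indicator (B j) (Z j x) :: real) * iexp (\<Sum>k\<in>I-I. 0 * Z k x))
          = complex_of_real (LINT x|L. indicator (Pi\<^sub>E I B) (\<lambda>i\<in>I. Z i x))"
        by (simp add: of_real_prod[symmetric] del: of_real_prod)
      also have "(LINT x|L. indicator (Pi\<^sub>E I B) (\<lambda>i\<in>I. Z i x))
          = (LINT y|distr L (PiM I (\<lambda>_. borel)) (\<lambda>\<omega>. \<lambda>i\<in>I. Z i \<omega>). indicator (Pi\<^sub>E I B) y :: real)"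
        by (subst integral_distr) auto
      finally show ?thesis by simp
    qed
    have "measure (distr M (PiM I (\<lambda>_. borel)) (\<lambda>\<omega>. \<lambda>i\<in>I. X i \<omega>)) (Pi\<^sub>E I B)
      = measure (distr N (PiM I (\<lambda>_. borel)) (\<lambda>\<omega>. \<lambda>i\<in>I. Y i \<omega>)) (Pi\<^sub>E I B)"
      using mixed[OF I subset_refl, of B "\<lambda>_. 0"] B *[OF XI] *[OF YI] by simp
    then show "emeasure (distr M (PiM I (\<lambda>_. borel)) (\<lambda>\<omega>. \<lambda>i\<in>I. X i \<omega>)) (prod_emb I (\<lambda>_. borel) J (Pi\<^sub>E J A))
      = emeasure (distr N (PiM I (\<lambda>_. borel)) (\<lambda>\<omega>. \<lambda>i\<in>I. Y i \<omega>)) (prod_emb I (\<lambda>_. borel) J (Pi\<^sub>E J A))"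
      unfolding PB
      by (simp add: finite_measure.emeasure_eq_measure[OF M.finite_measure_distr[OF XI]]
          finite_measure.emeasure_eq_measure[OF N.finite_measure_distr[OF YI]])
  qed auto
qed

section \<open>Gaussian laws\<close>

text \<open>Fixes the form in which centred Gaussian laws are compared from here on: a scaled
  standard normal. Scale 0 is the point mass at 0, so degenerate variables fit in without a separate
  case.\<close>

lemma distr_normal:
  assumes "prob_space M" "\<sigma> > 0" "distributed M lborel X (normal_density 0 \<sigma>)"
  shows "distr M borel X = distr std_normal_distribution borel ((*) \<sigma>)"
proof -
  interpret prob_space M by fact
  have X[measurable]: "X \<in> borel_measurable M"
    using assms(3) by (simp add: distributed_def)
  have "distributed M lborel (\<lambda>x. X x / \<sigma>) std_normal_density"
    using assms normal_standard_normal_convert[of \<sigma> X 0] by simp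
  then have "std_normal_distribution = distr M lborel (\<lambda>x. X x / \<sigma>)"
    by (simp add: distributed_def)
  then have "distr std_normal_distribution borel ((*) \<sigma>) = distr M borel ((*) \<sigma> \<circ> (\<lambda>x. X x / \<sigma>))"
    by (simp add: distr_distr)
  also have "(*) \<sigma> \<circ> (\<lambda>x. X x / \<sigma>) = X" using assms(2) by (auto simp: fun_eq_iff)
  finally show ?thesis ..
qed

lemma distr_zero:
  assumes "prob_space M" "X \<in> borel_measurable M" "AE x in M. X x = 0"
  shows "distr M borel X = distr std_normal_distribution borel ((*) (0::real))"
proof -
  have "distr M borel X = distr M borel (\<lambda>_. 0::real)"
    using assms by (intro distr_cong_AE) auto
  also have "\<dots> = return borel 0" by (simp add: prob_space.distr_const assms)
  also have "\<dots> = distr std_normal_distribution borel (\<lambda>_. 0::real)"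
    by (simp add: prob_space.distr_const prob_space_normal_density)
  also have "\<dots> = distr std_normal_distribution borel ((*) (0::real))"
    by (intro distr_cong) auto
  finally show ?thesis .
qed

lemma gaussian_var_centered:
  assumes "prob_space M" "gaussian_var M X" "prob_space.expectation M X = 0"
  obtains \<sigma> where "\<sigma> \<ge> 0" "distr M borel X = distr std_normal_distribution borel ((*) \<sigma>)"
proof -
  interpret prob_space M by fact
  have X[measurable]: "X \<in> borel_measurable M"
    using assms(2) by (simp add: gaussian_var_def)
  consider \<mu> \<sigma> where "\<sigma> > 0" "distributed M lborel X (normal_density \<mu> \<sigma>)"
    | \<mu> where "AE \<omega> in M. X \<omega> = \<mu>"
    using assms(2) by (auto simp: gaussian_var_def)
  then show ?thesis
  proof cases
    case 1
    then have "\<mu> = 0" using normal_distributed_expectation[of \<sigma> X \<mu>] assms(3) by simp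
    then show ?thesis using 1 distr_normal[of M \<sigma> X] assms(1) by (intro that[of \<sigma>]) auto
  next
    case 2
    have "expectation X = expectation (\<lambda>_. \<mu>)" using 2 by (intro integral_cong_AE) auto
    then have "\<mu> = 0" using assms(3) by (simp add: prob_space)
    then show ?thesis using 2 distr_zero[of M X] assms(1) by (intro that[of 0]) auto
  qed
qed

lemma gaussian_varI:
  assumes "prob_space M" and X[measurable]: "X \<in> borel_measurable M" and "\<sigma> \<ge> 0"
    and law: "distr M borel X = distr std_normal_distribution borel ((*) \<sigma>)"
  shows "gaussian_var M X"
proof (cases "\<sigma> = 0")
  case True
  have "AE y in distr M borel X. y = 0"
    unfolding law True by (subst AE_distr_iff) auto
  then have "AE \<omega> in M. X \<omega> = 0" by (subst (asm) AE_distr_iff) auto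
  then show ?thesis using X by (auto simp: gaussian_var_def)
next
  case False
  interpret S: prob_space std_normal_distribution by (rule prob_space_normal_density) simp
  have "distributed std_normal_distribution lborel (\<lambda>x. x) std_normal_density"
    by (auto simp: distributed_def intro!: distr_id2)
  from S.normal_density_affine[OF this, of \<sigma> 0] False assms(3)
  have "distributed std_normal_distribution lborel ((*) \<sigma>) (normal_density 0 \<sigma>)" by simp
  then have "distr std_normal_distribution lborel ((*) \<sigma>) = density lborel (normal_density 0 \<sigma>)"
    by (simp add: distributed_def)
  moreover have "distr M lborel X = distr M borel X" "distr std_normal_distribution lborel ((*) \<sigma>)
    = distr std_normal_distribution borel ((*) \<sigma>)" by (auto intro!: distr_cong)
  ultimately have "distributed M lborel X (normal_density 0 \<sigma>)"
    using law by (simp add: distributed_def)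
  then show ?thesis using False assms(3) by (auto simp: gaussian_var_def less_le)
qed

lemma moments_scaled_normal:
  assumes X[measurable]: "X \<in> borel_measurable M"
    and law: "distr M borel X = distr std_normal_distribution borel ((*) \<sigma>)"
  shows "integrable M X" "integrable M (\<lambda>x. (X x)\<^sup>2)" "(LINT x|M. (X x)\<^sup>2) = \<sigma>\<^sup>2"
proof -
  have transfer: "integrable M (\<lambda>x. f (X x)) \<longleftrightarrow> integrable std_normal_distribution (\<lambda>x. f (\<sigma> * x))"
    "(LINT x|M. f (X x)) = (LINT x|std_normal_distribution. f (\<sigma> * x))"
    if f[measurable]: "f \<in> borel_measurable borel" for f :: "real \<Rightarrow> real"
  proof -
    have "integrable M (\<lambda>x. f (X x)) \<longleftrightarrow> integrable (distr M borel X) f"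
      by (rule integrable_distr_eq[symmetric]) measurable
    also have "\<dots> \<longleftrightarrow> integrable std_normal_distribution (\<lambda>x. f (\<sigma> * x))"
      unfolding law by (rule integrable_distr_eq) measurable
    finally show "integrable M (\<lambda>x. f (X x)) \<longleftrightarrow> integrable std_normal_distribution (\<lambda>x. f (\<sigma> * x))" .
    have "(LINT x|M. f (X x)) = integral\<^sup>L (distr M borel X) f"
      by (rule integral_distr[symmetric]) measurable
    also have "\<dots> = (LINT x|std_normal_distribution. f (\<sigma> * x))"
      unfolding law by (rule integral_distr) measurable
    finally show "(LINT x|M. f (X x)) = (LINT x|std_normal_distribution. f (\<sigma> * x))" .
  qed
  show "integrable M X"
    using transfer(1)[of "\<lambda>x. x"]
      integrable_mult_right[OF integrable_std_normal_distribution_moment[of 1], of \<sigma>]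
    unfolding power_one_right by simp
  show "integrable M (\<lambda>x. (X x)\<^sup>2)"
    unfolding transfer(1)[of "\<lambda>x. x\<^sup>2", OF borel_measurable_power[OF measurable_ident_sets[OF refl]]] power_mult_distrib
    by (intro integrable_mult_right integrable_std_normal_distribution_moment)
  have "(LINT x|std_normal_distribution. x ^ (2 * 1)) = fact (2 * 1) / (2 ^ 1 * fact 1)"
    by (rule std_normal_distribution_even_moments)
  also have "fact (2 * 1) / (2 ^ 1 * fact 1) = (1::real)" by (simp add: fact_numeral)
  finally have "(LINT x|std_normal_distribution. x\<^sup>2) = 1" unfolding mult_1_right .
  then show "(LINT x|M. (X x)\<^sup>2) = \<sigma>\<^sup>2"
    unfolding transfer(2)[of "\<lambda>x. x\<^sup>2", OF borel_measurable_power[OF measurable_ident_sets[OF refl]]] power_mult_distrib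
    by simp
qed

section \<open>Second moments and Cauchy-Schwarz\<close>

lemma integrable_mult_square_integrable:
  fixes f g :: "'a \<Rightarrow> real"
  assumes [measurable]: "f \<in> borel_measurable M" "g \<in> borel_measurable M"
    and "integrable M (\<lambda>x. (f x)\<^sup>2)" "integrable M (\<lambda>x. (g x)\<^sup>2)"
  shows "integrable M (\<lambda>x. f x * g x)"
proof (rule Bochner_Integration.integrable_bound[where f="\<lambda>x. (f x)\<^sup>2 + (g x)\<^sup>2"])
  have "\<bar>f x * g x\<bar> \<le> (f x)\<^sup>2 + (g x)\<^sup>2" for x
  proof -
    have "2 * (\<bar>f x\<bar> * \<bar>g x\<bar>) \<le> (f x)\<^sup>2 + (g x)\<^sup>2"
      using sum_squares_bound[of "\<bar>f x\<bar>" "\<bar>g x\<bar>"] by simp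
    moreover have "0 \<le> \<bar>f x\<bar> * \<bar>g x\<bar>" by simp
    ultimately show ?thesis by (simp only: abs_mult)
  qed
  then show "AE x in M. norm (f x * g x) \<le> norm ((f x)\<^sup>2 + (g x)\<^sup>2)" by simp
qed (use assms in auto)

text \<open>The quadratic form \<open>(s, t) \<mapsto> E (s * f - t * g)^2\<close> is nonnegative;
  evaluating it at suitable points gives the bound.\<close>

lemma integral_mult_square_le:
  fixes f g :: "'a \<Rightarrow> real"
  assumes [measurable]: "f \<in> borel_measurable M" "g \<in> borel_measurable M"
    and i: "integrable M (\<lambda>x. (f x)\<^sup>2)" "integrable M (\<lambda>x. (g x)\<^sup>2)"
  shows "(LINT x|M. f x * g x)\<^sup>2 \<le> (LINT x|M. (f x)\<^sup>2) * (LINT x|M. (g x)\<^sup>2)"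
proof -
  note fg = integrable_mult_square_integrable[OF assms]
  let ?a = "LINT x|M. (f x)\<^sup>2" and ?b = "LINT x|M. f x * g x" and ?c = "LINT x|M. (g x)\<^sup>2"
  have q: "0 \<le> s\<^sup>2 * ?a - 2 * s * t * ?b + t\<^sup>2 * ?c" for s t
  proof -
    have "0 \<le> (LINT x|M. (s * f x - t * g x)\<^sup>2)" by simp
    also have "(LINT x|M. (s * f x - t * g x)\<^sup>2)
        = (LINT x|M. s\<^sup>2 * (f x)\<^sup>2 - (2 * s * t) * (f x * g x) + t\<^sup>2 * (g x)\<^sup>2)"
      by (simp add: power2_eq_square algebra_simps)
    also have "\<dots> = s\<^sup>2 * ?a - 2 * s * t * ?b + t\<^sup>2 * ?c"
      using i fg by simp
    finally show ?thesis .
  qed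
  show ?thesis
  proof (cases "?a = 0")
    case True
    have "0 \<le> - 2 * s * ?b + ?c" for s using q[of s 1] True by simp
    \<comment> \<open>The value of \<open>s\<close> is chosen so that the right-hand side becomes
      -1.\<close>
    from this[of "(?c + 1) / (2 * ?b)"] have "?b = 0" by (cases "?b = 0") (auto simp: field_simps)
    then show ?thesis by simp
  next
    case False
    then have a: "?a > 0" using less_le by fastforce
    \<comment> \<open>The minimising direction \<open>s = ?b\<close>, \<open>t = ?a\<close>, kept
      free of fractions.\<close>
    have "0 \<le> ?a * (?a * ?c - ?b\<^sup>2)" using q[of ?b ?a] by (simp add: power2_eq_square algebra_simps)
    then show ?thesis using a by (simp add: zero_le_mult_iff)
  qed
qed

section \<open>Laws of linear combinations\<close>

lemma jointly_gaussian_component: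
  assumes "jointly_gaussian M I X" "i \<in> I"
  shows "gaussian_var M (X i)"
proof -
  have "finite I" using assms by (simp add: jointly_gaussian_def)
  have "gaussian_var M (\<lambda>\<omega>. \<Sum>k\<in>I. (if k = i then 1 else 0) * X k \<omega>)"
    using assms by (simp add: jointly_gaussian_def)
  moreover have "(\<Sum>k\<in>I. (if k = i then 1 else 0) * X k \<omega>) = X i \<omega>" for \<omega>
  proof -
    have "(\<Sum>k\<in>I. (if k = i then 1 else 0) * X k \<omega>) = (\<Sum>k\<in>I. if k = i then X k \<omega> else 0)"
      by (intro sum.cong) auto
    then show ?thesis using assms(2) \<open>finite I\<close> by simp
  qed
  ultimately show ?thesis by simp
qed

text \<open>A linear combination is Gaussian and centred, hence determined by its variance, which is
  the quadratic form of the second moments. This is why matching covariances suffices for matching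
  laws.\<close>

lemma jointly_gaussian_law:
  assumes M: "prob_space M" and X: "jointly_gaussian M I X"
    and mean: "\<And>i. i \<in> I \<Longrightarrow> prob_space.expectation M (X i) = 0"
  shows "\<And>i. i \<in> I \<Longrightarrow> X i \<in> borel_measurable M"
    and "\<And>i. i \<in> I \<Longrightarrow> integrable M (X i)"
    and "\<And>i. i \<in> I \<Longrightarrow> integrable M (\<lambda>\<omega>. (X i \<omega>)\<^sup>2)"
    and "distr M borel (\<lambda>\<omega>. \<Sum>i\<in>I. c i * X i \<omega>) = distr std_normal_distribution borel
      ((*) (sqrt (\<Sum>i\<in>I. \<Sum>j\<in>I. c i * c j * (LINT \<omega>|M. X i \<omega> * X j \<omega>))))"
proof -
  interpret prob_space M by fact
  show m: "X i \<in> borel_measurable M" if "i \<in> I" for i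
    using X that by (simp add: jointly_gaussian_def)
  have i: "integrable M (X i) \<and> integrable M (\<lambda>\<omega>. (X i \<omega>)\<^sup>2)" if "i \<in> I" for i
    using gaussian_var_centered[OF M jointly_gaussian_component[OF X that] mean[OF that]]
      moments_scaled_normal[OF m[OF that]] by metis
  then show "\<And>i. i \<in> I \<Longrightarrow> integrable M (X i)" "\<And>i. i \<in> I \<Longrightarrow> integrable M (\<lambda>\<omega>. (X i \<omega>)\<^sup>2)"
    by auto
  have ij: "integrable M (\<lambda>\<omega>. X i \<omega> * X j \<omega>)" if "i \<in> I" "j \<in> I" for i j
    using that i m by (intro integrable_mult_square_integrable) auto
  let ?S = "\<lambda>\<omega>. \<Sum>i\<in>I. c i * X i \<omega>"
  have S: "gaussian_var M ?S" using X by (simp add: jointly_gaussian_def)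
  then have Sm: "?S \<in> borel_measurable M" by (simp add: gaussian_var_def)
  have "expectation ?S = 0" using i mean by (simp add: Bochner_Integration.integral_sum)
  with gaussian_var_centered[OF M S] obtain \<sigma>
    where \<sigma>: "\<sigma> \<ge> 0" "distr M borel ?S = distr std_normal_distribution borel ((*) \<sigma>)" by blast
  have "\<sigma>\<^sup>2 = (LINT \<omega>|M. (?S \<omega>)\<^sup>2)" using moments_scaled_normal(3)[OF Sm \<sigma>(2)] by simp
  also have "\<dots> = (LINT \<omega>|M. (\<Sum>i\<in>I. \<Sum>j\<in>I. c i * c j * (X i \<omega> * X j \<omega>)))"
    unfolding power2_eq_square sum_product
    by (intro Bochner_Integration.integral_cong sum.cong refl) (simp add: mult_ac)
  also have "\<dots> = (\<Sum>i\<in>I. \<Sum>j\<in>I. c i * c j * (LINT \<omega>|M. X i \<omega> * X j \<omega>))"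
    using ij by (simp add: Bochner_Integration.integral_sum)
  finally have "sqrt (\<Sum>i\<in>I. \<Sum>j\<in>I. c i * c j * (LINT \<omega>|M. X i \<omega> * X j \<omega>)) = \<sigma>"
    using \<sigma>(1) by (rule real_sqrt_unique)
  then show "distr M borel ?S = distr std_normal_distribution borel
      ((*) (sqrt (\<Sum>i\<in>I. \<Sum>j\<in>I. c i * c j * (LINT \<omega>|M. X i \<omega> * X j \<omega>))))"
    using \<sigma>(2) by (simp only:)
qed

lemma distr_sum_std_normal:
  assumes I: "finite I"
  shows "distr (PiM I (\<lambda>_. std_normal_distribution)) borel (\<lambda>\<omega>. \<Sum>i\<in>I. e i * \<omega> i)
    = distr std_normal_distribution borel ((*) (sqrt (\<Sum>i\<in>I. (e i)\<^sup>2)))"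
proof -
  let ?N = "PiM I (\<lambda>_. std_normal_distribution)"
  have std: "prob_space std_normal_distribution" by (rule prob_space_normal_density) simp
  interpret N: prob_space ?N by (intro prob_space_PiM std)
  have m[measurable]: "(\<lambda>\<omega>. \<omega> i) \<in> borel_measurable ?N" if "i \<in> I" for i
    using measurable_component_singleton[OF that, of "\<lambda>_. std_normal_distribution"] by simp
  \<comment> \<open>Sums of independent normals are available for positive standard deviations, so
    zero coefficients are dropped first. An empty \<open>J\<close> leaves the point mass at
    0.\<close>
  define J where "J = {i \<in> I. e i \<noteq> 0}"
  have J: "finite J" "J \<subseteq> I" using I by (auto simp: J_def)
  have sumJ: "(\<Sum>i\<in>I. e i * \<omega> i) = (\<Sum>i\<in>J. e i * \<omega> i)" for \<omega> :: "'a \<Rightarrow> real"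
    using I by (intro sum.mono_neutral_right) (auto simp: J_def)
  have varJ: "(\<Sum>i\<in>I. (e i)\<^sup>2) = (\<Sum>i\<in>J. (e i)\<^sup>2)"
    using I by (intro sum.mono_neutral_right) (auto simp: J_def)
  show ?thesis
  proof (cases "J = {}")
    case True
    then show ?thesis unfolding sumJ varJ
      using distr_zero[OF N.prob_space_axioms, of "\<lambda>_. 0"] by simp
  next
    case False
    have ind: "N.indep_vars (\<lambda>_. borel) (\<lambda>i \<omega>. \<omega> i) I"
    proof (subst N.indep_vars_iff_distr_eq_PiM')
      have "distr ?N (PiM I (\<lambda>_. borel)) (\<lambda>x. \<lambda>i\<in>I. x i) = distr ?N ?N (\<lambda>x. x)"
        by (intro distr_cong sets_PiM_cong) (auto simp: space_PiM PiE_iff extensional_restrict cong: sets_PiM_cong)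
      also have "\<dots> = ?N" by (rule distr_id)
      also have "\<dots> = PiM I (\<lambda>i. distr ?N borel (\<lambda>\<omega>. \<omega> i))"
      proof (intro PiM_cong refl)
        fix i assume "i \<in> I"
        have "distr ?N borel (\<lambda>\<omega>. \<omega> i) = distr ?N std_normal_distribution (\<lambda>\<omega>. \<omega> i)"
          by (intro distr_cong) auto
        then show "std_normal_distribution = distr ?N borel (\<lambda>\<omega>. \<omega> i)"
          using distr_PiM_component[of I "\<lambda>_. std_normal_distribution" i] std \<open>i \<in> I\<close> by simp
      qed
      finally show "distr ?N (PiM I (\<lambda>_. borel)) (\<lambda>x. \<lambda>i\<in>I. x i) = PiM I (\<lambda>i. distr ?N borel (\<lambda>\<omega>. \<omega> i))" .
    qed (use False J in auto)
    have "N.indep_vars (\<lambda>_. borel) (\<lambda>i \<omega>. e i * \<omega> i) J"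
      by (rule N.indep_vars_compose2[OF N.indep_vars_subset[OF ind J(2)]]) simp
    moreover have "distributed ?N lborel (\<lambda>\<omega>. e i * \<omega> i) (normal_density 0 \<bar>e i\<bar>)" if "i \<in> J" for i
    proof -
      have i: "i \<in> I" "e i \<noteq> 0" using that by (auto simp: J_def)
      have "distr ?N lborel (\<lambda>\<omega>. \<omega> i) = distr ?N std_normal_distribution (\<lambda>\<omega>. \<omega> i)"
        by (intro distr_cong) auto
      then have "distributed ?N lborel (\<lambda>\<omega>. \<omega> i) std_normal_density"
        using distr_PiM_component[of I "\<lambda>_. std_normal_distribution" i] std i m[OF i(1)]
        by (simp add: distributed_def)
      from N.normal_density_affine[OF this, of "e i" 0] i show ?thesis by simp
    qed
    ultimately have "distributed ?N lborel (\<lambda>\<omega>. \<Sum>i\<in>J. e i * \<omega> i)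
        (normal_density (\<Sum>i\<in>J. 0) (sqrt (\<Sum>i\<in>J. \<bar>e i\<bar>\<^sup>2)))"
      using False J by (intro N.sum_indep_normal) (auto simp: J_def)
    then have D: "distributed ?N lborel (\<lambda>\<omega>. \<Sum>i\<in>J. e i * \<omega> i) (normal_density 0 (sqrt (\<Sum>i\<in>J. (e i)\<^sup>2)))"
      by simp
    have "(\<Sum>i\<in>J. (e i)\<^sup>2) > 0"
      using False J by (intro sum_pos) (auto simp: J_def)
    then show ?thesis unfolding sumJ varJ by (intro distr_normal[OF N.prob_space_axioms _ D]) simp
  qed
qed

section \<open>Star graphs\<close>

definition star_graph :: "'v \<Rightarrow> 'v set \<Rightarrow> 'v pair_pre_digraph" where
  "star_graph r L = \<lparr>pverts = insert r L, parcs = {r} \<times> L \<union> L \<times> {r}\<rparr>"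

lemma star_graph_simps [simp]:
  "pverts (star_graph r L) = insert r L"
  "parcs (star_graph r L) = {r} \<times> L \<union> L \<times> {r}"
  by (simp_all add: star_graph_def)

lemma reachable_via_hub:
  assumes r: "r \<in> verts G"
    and hub: "\<And>x. x \<in> verts G \<Longrightarrow> x \<noteq> r \<Longrightarrow> (x, r) \<in> arcs_ends G \<and> (r, x) \<in> arcs_ends G"
    and uv: "u \<in> verts G" "v \<in> verts G"
  shows "u \<rightarrow>\<^sup>*\<^bsub>G\<^esub> v"
proof -
  have "(u, r) \<in> rtrancl_on (verts G) (arcs_ends G)"
    using hub[OF uv(1)] r uv(1) by (cases "u = r") (auto intro: rtrancl_on_into_rtrancl_on[of u u])
  then show ?thesis unfolding reachable_def
    using hub[OF uv(2)] uv(2) by (cases "v = r") (auto intro: rtrancl_on_into_rtrancl_on)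
qed

text \<open>Every arc joins \<open>r\<close> to a leaf, so a walk alternates between them. Along
  three arcs \<open>a\<close>, \<open>b\<close>, \<open>e\<close> the vertex \<open>r\<close> is met
  twice, two arcs apart: either at the start and after \<open>b\<close>, or after \<open>a\<close>
  and after \<open>e\<close>. Distinctness of the cycle vertices excludes both.\<close>

lemma star_graph_no_cycle:
  assumes "r \<notin> L" "pre_digraph.cycle (with_proj (star_graph r L)) p"
  shows "length p < 3"
proof (rule ccontr)
  assume "\<not> length p < 3"
  then obtain a b e q where p: "p = a # b # e # q"
    by (metis One_nat_def length_Cons less_Suc_eq_0_disj list.exhaust list.size(3) numeral_3_eq_3 zero_less_Suc not_less_eq)
  obtain u where cas: "pcas u p u" and sub: "set p \<subseteq> parcs (star_graph r L)"
    and dist: "distinct (tl (pawalk_verts u p))"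
    using assms(2) by (auto simp: pre_digraph.cycle_def pre_digraph.awalk_def cas_with_proj_eq awalk_verts_with_proj_eq)
  have last: "last (pawalk_verts v l) = w \<and> pawalk_verts v l \<noteq> []" if "pcas v l w" for v l w
    using that by (induction l arbitrary: v) auto
  have ab: "fst a = u" "fst b = snd a" "fst e = snd b" "pcas (snd e) q u"
    using cas by (auto simp: p)
  have d: "snd a \<noteq> snd b" "snd b \<notin> set (pawalk_verts (snd e) q)"
    using dist ab by (auto simp: p)
  \<comment> \<open>The cycle closes up, so its start \<open>u\<close> reappears as the last vertex
    of the remaining walk, where \<open>snd b\<close> cannot occur.\<close>
  have "u \<in> set (pawalk_verts (snd e) q)" using last[OF ab(4)] last_in_set by metis
  with d have "u \<noteq> snd b" by auto
  moreover have "snd a \<noteq> snd e"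
    using dist ab last[OF ab(4)] by (cases q) (auto simp: p)
  ultimately show False
    using sub ab d assms(1) by (cases a; cases b; cases e) (auto simp: p)
qed

lemma undirected_tree_star_graph:
  assumes "finite L" "r \<notin> L"
  shows "undirected_tree (star_graph r L)"
proof -
  have "pair_graph (star_graph r L)"
    using assms by unfold_locales (auto simp: symmetric_def intro!: symI)
  moreover have "Digraph_Component.connected (with_proj (star_graph r L))"
    unfolding Digraph_Component.connected_def strongly_connected_def
    by (auto intro!: reachable_via_hub[of r] simp: mk_symmetric_def)
  ultimately show ?thesis
    using star_graph_no_cycle[OF assms(2)] by (auto simp: undirected_tree_def not_le)
qed

text \<open>The hub survives the removal of a leaf and connects everything that is left. The
  inclusion is the form consumed by \<open>cond_indep_vars_single\<close>.\<close>

lemma components_without_leaf: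
  assumes "v \<in> L" "r \<notin> L"
  shows "components_without (star_graph r L) v \<subseteq> {insert r (L - {v})}"
proof
  let ?G = "pre_digraph.del_vert (with_proj (star_graph r L)) v"
  fix S assume "S \<in> components_without (star_graph r L) v"
  then have S: "S \<noteq> {}" "\<And>x y. x \<in> S \<Longrightarrow> y \<in> S \<Longrightarrow> x \<rightarrow>\<^sup>*\<^bsub>?G\<^esub> y"
      "\<And>x y. x \<in> S \<Longrightarrow> y \<notin> S \<Longrightarrow> \<not> x \<rightarrow>\<^sup>*\<^bsub>?G\<^esub> y \<or> \<not> y \<rightarrow>\<^sup>*\<^bsub>?G\<^esub> x"
    by (auto simp: components_without_def pre_digraph.sccs_verts_def)
  have verts: "verts ?G = insert r (L - {v})"
    using assms by (auto simp: pre_digraph.del_vert_def)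
  have arcs: "arcs_ends ?G = {r} \<times> (L - {v}) \<union> (L - {v}) \<times> {r}"
    using assms by (force simp: pre_digraph.del_vert_def arcs_ends_conv)
  have "S \<subseteq> verts ?G" using S(2) by (auto simp: reachable_def dest: in_rtrancl_on_in_F)
  moreover obtain x where x: "x \<in> S" using S(1) by auto
  have "y \<in> S" if "y \<in> verts ?G" for y
  proof (rule ccontr)
    assume "y \<notin> S"
    have "x \<rightarrow>\<^sup>*\<^bsub>?G\<^esub> y" "y \<rightarrow>\<^sup>*\<^bsub>?G\<^esub> x"
      using x that \<open>S \<subseteq> verts ?G\<close> by (auto intro!: reachable_via_hub[of r] simp: verts arcs)
    then show False using S(3)[OF x \<open>y \<notin> S\<close>] by auto
  qed
  ultimately show "S \<in> {insert r (L - {v})}" using verts by auto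
qed

lemma components_without_root:
  assumes "r \<notin> L"
  shows "components_without (star_graph r L) r = (\<lambda>i. {i}) ` L"
proof -
  let ?G = "pre_digraph.del_vert (with_proj (star_graph r L)) r"
  have verts: "verts ?G = L"
    using assms by (auto simp: pre_digraph.del_vert_def)
  have arcs: "arcs_ends ?G = {}"
    using assms by (force simp: pre_digraph.del_vert_def arcs_ends_conv)
  have "(a, b) \<in> rtrancl_on L {} \<longleftrightarrow> a = b \<and> a \<in> L" for a b
    by (auto elim: rtrancl_on.cases)
  then have reach: "a \<rightarrow>\<^sup>*\<^bsub>?G\<^esub> b \<longleftrightarrow> a = b \<and> a \<in> L" for a b
    unfolding reachable_def verts arcs .
  show ?thesis
  proof (intro equalityI subsetI)
    fix S assume "S \<in> components_without (star_graph r L) r"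
    then have S: "S \<noteq> {}" "\<And>x y. x \<in> S \<Longrightarrow> y \<in> S \<Longrightarrow> x = y \<and> x \<in> L"
      by (simp_all add: components_without_def pre_digraph.sccs_verts_def reach)
    then obtain x where "x \<in> S" by auto
    with S have "S = {x}" "x \<in> L" by auto
    then show "S \<in> (\<lambda>i. {i}) ` L" by simp
  next
    fix S assume "S \<in> (\<lambda>i. {i}) ` L"
    then show "S \<in> components_without (star_graph r L) r"
      by (auto simp: components_without_def pre_digraph.sccs_verts_def reach)
  qed
qed

section \<open>Gauss-Markov stars\<close>

text \<open>A single component gives products with one factor. This disposes of the Markov condition
  at every leaf, so only the hub carries content.\<close>

lemma cond_indep_vars_single:
  assumes "I \<subseteq> {C}" "\<And>i. i \<in> I \<Longrightarrow> X i \<in> measurable M (M' i)"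
  shows "cond_indep_vars M G M' X I"
proof -
  have "AE \<omega> in M. real_cond_exp M G (indicator (\<Inter>j\<in>J. A j)) \<omega> =
          (\<Prod>j\<in>J. real_cond_exp M G (indicator (A j)) \<omega>)" if "J \<subseteq> I" "J \<noteq> {}" for J A
  proof -
    have "J = {C}" using that assms(1) by auto
    then show ?thesis by simp
  qed
  then show ?thesis
    using assms(2) by (auto simp: cond_indep_vars_def cond_indep_sets_def)
qed

section \<open>Independent standard normals conditioned on one coordinate\<close>

abbreviation std_normals :: "'v set \<Rightarrow> ('v \<Rightarrow> real) measure" where
  "std_normals I \<equiv> PiM I (\<lambda>_. std_normal_distribution)"

lemma prob_space_std_normal: "prob_space std_normal_distribution"
  by (rule prob_space_normal_density) simp

text \<open>Once the hub value \<open>z\<close> is fixed, the leaves depend on separate independent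
  coordinates, so the probability factors into the numbers \<open>g i z\<close>. The defining
  property of conditional expectation is checked on events \<open>\<omega> r \<in> Z\<close> by
  Fubini.\<close>

lemma std_normals_cond_exp_all:
  assumes L: "finite L" "r \<notin> L" and B: "\<And>i. i \<in> L \<Longrightarrow> B i \<in> sets (borel :: real measure)"
  shows "AE \<omega> in std_normals (insert r L).
    real_cond_exp (std_normals (insert r L)) (vimage_algebra (space (std_normals (insert r L))) (\<lambda>\<omega>. \<omega> r) borel)
      (indicator {\<omega> \<in> space (std_normals (insert r L)). \<forall>i\<in>L. c i * \<omega> r + d i * \<omega> i \<in> B i}) \<omega>
    = (\<Prod>i\<in>L. measure std_normal_distribution {x. c i * \<omega> r + d i * x \<in> B i})"
proof -
  let ?S = "std_normal_distribution"
  let ?N = "std_normals (insert r L)"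
  let ?G = "vimage_algebra (space ?N) (\<lambda>\<omega>. \<omega> r) borel"
  let ?E = "{\<omega> \<in> space ?N. \<forall>i\<in>L. c i * \<omega> r + d i * \<omega> i \<in> B i}"
  define g where "g i z = measure ?S {x. c i * z + d i * x \<in> B i}" for i z
  interpret S: prob_space ?S by (rule prob_space_std_normal)
  interpret N: prob_space ?N by (intro prob_space_PiM prob_space_std_normal)
  interpret P: product_prob_space "\<lambda>_. ?S" "insert r L" by unfold_locales
  have m: "(\<lambda>\<omega>. \<omega> i) \<in> borel_measurable ?N" if "i \<in> insert r L" for i
    using measurable_component_singleton[OF that, of "\<lambda>_. ?S"] by simp
  have mr: "(\<lambda>\<omega>. \<omega> r) \<in> borel_measurable ?N" by (rule m) simp
  have sub: "subalgebra ?N ?G"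
    unfolding subalgebra_def by (auto simp: sets_vimage_algebra2 measurable_sets[OF mr])
  interpret G: finite_measure_subalgebra ?N ?G by unfold_locales (rule sub)
  have Bm: "{x. c i * z + d i * x \<in> B i} \<in> sets borel" if "i \<in> L" for i z
  proof -
    have "(\<lambda>x. c i * z + d i * x) -` B i \<inter> space borel \<in> sets borel"
      by (rule measurable_sets[OF _ B[OF that]]) simp
    then show ?thesis by (simp add: vimage_def)
  qed
  \<comment> \<open>As an integral with parameter \<open>z\<close>, the function \<open>g i\<close>
    is seen to be measurable in \<open>z\<close>.\<close>
  have eg: "ennreal (g i z) = (\<integral>\<^sup>+ x. indicator (B i) (c i * z + d i * x) \<partial>?S)" if "i \<in> L" for i z
  proof -
    have "(\<integral>\<^sup>+ x. indicator (B i) (c i * z + d i * x) \<partial>?S)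
        = (\<integral>\<^sup>+ x. indicator {x. c i * z + d i * x \<in> B i} x \<partial>?S)"
      by (intro nn_integral_cong) (auto simp: indicator_def)
    also have "\<dots> = emeasure ?S {x. c i * z + d i * x \<in> B i}" using Bm[OF that] by simp
    finally show ?thesis by (simp add: g_def S.emeasure_eq_measure)
  qed
  have g01: "0 \<le> g i z" "g i z \<le> 1" for i z by (auto simp: g_def)
  have gm: "g i \<in> borel_measurable borel" if "i \<in> L" for i
  proof -
    note [measurable] = B[OF that]
    have "(\<lambda>z. \<integral>\<^sup>+ x. indicator (B i) (c i * z + d i * x) \<partial>?S) \<in> borel_measurable borel"
      by measurable
    then have "(\<lambda>z. enn2real (ennreal (g i z))) \<in> borel_measurable borel"
      using eg[OF that] by simp
    then show ?thesis by (simp add: g01)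
  qed
  have Em[measurable]: "?E \<in> sets ?N"
  proof -
    have "{\<omega> \<in> space ?N. c i * \<omega> r + d i * \<omega> i \<in> B i} \<in> sets ?N" if "i \<in> L" for i
    proof -
      note [measurable] = B[OF that] mr
      have [measurable]: "(\<lambda>\<omega>. \<omega> i) \<in> borel_measurable ?N" using that by (intro m) auto
      show ?thesis by measurable
    qed
    then show ?thesis using L(1) by (intro sets.sets_Collect_finite_All) auto
  qed
  have "AE \<omega> in ?N. real_cond_exp ?N ?G (indicator ?E) \<omega> = (\<Prod>i\<in>L. g i (\<omega> r))"
  proof (rule G.real_cond_exp_charact)
    show "integrable ?N (indicator ?E :: _ \<Rightarrow> real)"
      by (rule integrable_real_indicator) (auto simp: N.emeasure_eq_measure)
    have pm: "(\<lambda>z. \<Prod>i\<in>L. g i z) \<in> borel_measurable borel"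
      by (intro borel_measurable_prod gm)
    show "(\<lambda>\<omega>. \<Prod>i\<in>L. g i (\<omega> r)) \<in> borel_measurable ?G"
      by (rule measurable_compose[OF measurable_vimage_algebra1 pm]) simp
    have pmN[measurable]: "(\<lambda>\<omega>. \<Prod>i\<in>L. g i (\<omega> r)) \<in> borel_measurable ?N"
      by (rule measurable_compose[OF mr pm])
    have p01: "0 \<le> (\<Prod>i\<in>L. g i z)" "(\<Prod>i\<in>L. g i z) \<le> 1" for z
      using g01 by (auto intro: prod_nonneg prod_le_1)
    then show "integrable ?N (\<lambda>\<omega>. \<Prod>i\<in>L. g i (\<omega> r))"
      using pmN by (intro N.integrable_const_bound[where B=1]) auto
    fix A assume "A \<in> sets ?G"
    then obtain Z where Z[measurable]: "Z \<in> sets borel" and A: "A = (\<lambda>\<omega>. \<omega> r) -` Z \<inter> space ?N"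
      by (auto simp: sets_vimage_algebra2)
    have Am[measurable]: "A \<in> sets ?N" unfolding A by (rule measurable_sets[OF mr Z])
    have indm: "(\<lambda>\<omega>. \<Prod>i\<in>L. indicator (B i) (c i * \<omega> r + d i * \<omega> i) :: ennreal) \<in> borel_measurable ?N"
    proof (intro borel_measurable_prod_ennreal)
      fix i assume i: "i \<in> L"
      note [measurable] = B[OF i] mr
      have [measurable]: "(\<lambda>\<omega>. \<omega> i) \<in> borel_measurable ?N" using i by (intro m) auto
      show "(\<lambda>\<omega>. indicator (B i) (c i * \<omega> r + d i * \<omega> i) :: ennreal) \<in> borel_measurable ?N"
        by measurable
    qed
    have zm: "(\<lambda>\<omega>. indicator Z (\<omega> r) :: ennreal) \<in> borel_measurable ?N"
      by (rule measurable_compose[OF mr borel_measurable_indicator[OF Z]])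
    have "(\<integral>\<^sup>+ \<omega>. indicator A \<omega> * indicator ?E \<omega> \<partial>?N)
        = (\<integral>\<^sup>+ \<omega>. indicator Z (\<omega> r) * (\<Prod>i\<in>L. indicator (B i) (c i * \<omega> r + d i * \<omega> i)) \<partial>?N)"
      using L(1) by (intro nn_integral_cong) (auto simp: A indicator_def)
    \<comment> \<open>Fubini with the hub coordinate outside and the noise coordinates
      inside.\<close>
    also have "\<dots> = (\<integral>\<^sup>+ z. (\<integral>\<^sup>+ x. indicator Z ((x(r := z)) r) *
          (\<Prod>i\<in>L. indicator (B i) (c i * (x(r := z)) r + d i * (x(r := z)) i)) \<partial>std_normals L) \<partial>?S)"
      by (rule P.product_nn_integral_insert_rev[OF L borel_measurable_times_ennreal[OF zm indm]])
    also have "\<dots> = (\<integral>\<^sup>+ z. (\<integral>\<^sup>+ x. indicator Z z *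
          (\<Prod>i\<in>L. indicator (B i) (c i * z + d i * x i)) \<partial>std_normals L) \<partial>?S)"
      using L(2) by (intro nn_integral_cong arg_cong2[where f="(*)"] prod.cong) auto
    also have "\<dots> = (\<integral>\<^sup>+ z. indicator Z z * ennreal (\<Prod>i\<in>L. g i z) \<partial>?S)"
    proof (intro nn_integral_cong)
      fix z :: real
      have im: "(\<lambda>x. indicator (B i) (c i * z + d i * x) :: ennreal) \<in> borel_measurable ?S" if "i \<in> L" for i
      proof -
        note [measurable] = B[OF that]
        show ?thesis by measurable
      qed
      have im': "(\<lambda>x. indicator (B i) (c i * z + d i * x i) :: ennreal) \<in> borel_measurable (std_normals L)" if "i \<in> L" for i
        using measurable_compose[OF measurable_component_singleton[OF that, of "\<lambda>_. ?S"] im[OF that]] .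
      have "(\<integral>\<^sup>+ x. indicator Z z * (\<Prod>i\<in>L. indicator (B i) (c i * z + d i * x i)) \<partial>std_normals L)
          = indicator Z z * (\<integral>\<^sup>+ x. (\<Prod>i\<in>L. indicator (B i) (c i * z + d i * x i)) \<partial>std_normals L)"
        by (intro nn_integral_cmult borel_measurable_prod_ennreal im')
      also have "(\<integral>\<^sup>+ x. (\<Prod>i\<in>L. indicator (B i) (c i * z + d i * x i)) \<partial>std_normals L)
          = (\<Prod>i\<in>L. \<integral>\<^sup>+ x. indicator (B i) (c i * z + d i * x) \<partial>?S)"
        by (rule P.product_nn_integral_prod[OF L(1) im])
      also have "\<dots> = ennreal (\<Prod>i\<in>L. g i z)"
        using eg g01 by (simp add: prod_ennreal[symmetric])
      finally show "(\<integral>\<^sup>+ x. indicator Z z * (\<Prod>i\<in>L. indicator (B i) (c i * z + d i * x i)) \<partial>std_normals L)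
          = indicator Z z * ennreal (\<Prod>i\<in>L. g i z)" .
    qed
    \<comment> \<open>Coordinate \<open>r\<close> is itself standard normal under \<open>?N\<close>,
      which carries the integral over \<open>z\<close> back to the product space.\<close>
    also have "\<dots> = (\<integral>\<^sup>+ z. indicator Z z * ennreal (\<Prod>i\<in>L. g i z) \<partial>distr ?N ?S (\<lambda>\<omega>. \<omega> r))"
      by (subst distr_PiM_component[of "insert r L" "\<lambda>_. ?S"]) (auto simp: prob_space_std_normal)
    also have "\<dots> = (\<integral>\<^sup>+ \<omega>. indicator Z (\<omega> r) * ennreal (\<Prod>i\<in>L. g i (\<omega> r)) \<partial>?N)"
      using pm Z measurable_component_singleton[of r "insert r L" "\<lambda>_. ?S"]
      by (subst nn_integral_distr) auto
    also have "\<dots> = (\<integral>\<^sup>+ \<omega>. indicator A \<omega> * ennreal (\<Prod>i\<in>L. g i (\<omega> r)) \<partial>?N)"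
      by (intro nn_integral_cong) (auto simp: A indicator_def)
    finally have eq: "(\<integral>\<^sup>+ \<omega>. indicator A \<omega> * indicator ?E \<omega> \<partial>?N)
        = (\<integral>\<^sup>+ \<omega>. indicator A \<omega> * ennreal (\<Prod>i\<in>L. g i (\<omega> r)) \<partial>?N)" .
    have "(\<integral>\<omega>\<in>A. indicator ?E \<omega> \<partial>?N) = enn2real (\<integral>\<^sup>+ \<omega>. indicator A \<omega> * indicator ?E \<omega> \<partial>?N)"
      unfolding set_lebesgue_integral_def
      by (subst integral_eq_nn_integral) (auto intro!: arg_cong[where f=enn2real] nn_integral_cong simp: indicator_def)
    also have "\<dots> = (\<integral>\<omega>\<in>A. (\<Prod>i\<in>L. g i (\<omega> r)) \<partial>?N)"
      unfolding eq set_lebesgue_integral_def using p01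
      by (subst integral_eq_nn_integral) (auto intro!: arg_cong[where f=enn2real] nn_integral_cong simp: indicator_def)
    finally show "(\<integral>\<omega>\<in>A. indicator ?E \<omega> \<partial>?N) = (\<integral>\<omega>\<in>A. (\<Prod>i\<in>L. g i (\<omega> r)) \<partial>?N)" .
  qed
  then show ?thesis by (simp add: g_def)
qed

text \<open>Leaves outside \<open>K\<close> are left unconstrained by \<open>UNIV\<close> and
  contribute the factor 1. Conditional independence uses it twice: for intersections over
  \<open>K\<close> and for single leaves.\<close>

lemma std_normals_cond_exp:
  assumes L: "finite L" "r \<notin> L" and K: "K \<subseteq> L" and B: "\<And>i. i \<in> K \<Longrightarrow> B i \<in> sets (borel :: real measure)"
  shows "AE \<omega> in std_normals (insert r L).
    real_cond_exp (std_normals (insert r L)) (vimage_algebra (space (std_normals (insert r L))) (\<lambda>\<omega>. \<omega> r) borel)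
      (indicator {\<omega> \<in> space (std_normals (insert r L)). \<forall>i\<in>K. c i * \<omega> r + d i * \<omega> i \<in> B i}) \<omega>
    = (\<Prod>i\<in>K. measure std_normal_distribution {x. c i * \<omega> r + d i * x \<in> B i})"
proof -
  interpret S: prob_space std_normal_distribution by (rule prob_space_std_normal)
  define B' where "B' i = (if i \<in> K then B i else UNIV)" for i
  have "{\<omega> \<in> space (std_normals (insert r L)). \<forall>i\<in>L. c i * \<omega> r + d i * \<omega> i \<in> B' i}
      = {\<omega> \<in> space (std_normals (insert r L)). \<forall>i\<in>K. c i * \<omega> r + d i * \<omega> i \<in> B i}"
    using K by (auto simp: B'_def)
  moreover have "(\<Prod>i\<in>L. measure std_normal_distribution {x. c i * z + d i * x \<in> B' i})
      = (\<Prod>i\<in>K. measure std_normal_distribution {x. c i * z + d i * x \<in> B i})" for z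
    using L K S.prob_space by (intro prod.mono_neutral_cong_right) (auto simp: B'_def)
  ultimately show ?thesis
    using std_normals_cond_exp_all[OF L, of B' c d] B by (auto simp: B'_def)
qed

text \<open>Vertices double as coordinates of the sample point. With vertices in \<open>nat\<close>
  the sample space consists of functions from \<open>nat\<close> to \<open>real\<close>, as the
  notion of embeddability asks.\<close>

definition star_var :: "'v \<Rightarrow> ('v \<Rightarrow> real) \<Rightarrow> ('v \<Rightarrow> real) \<Rightarrow> 'v \<Rightarrow> ('v \<Rightarrow> real) \<Rightarrow> real" where
  "star_var r c d i \<omega> = (if i = r then \<omega> r else c i * \<omega> r + d i * \<omega> i)"

lemma measurable_star_var:
  assumes "i \<in> insert r L"
  shows "star_var r c d i \<in> borel_measurable (std_normals (insert r L))"
proof -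
  have m[measurable]: "(\<lambda>\<omega>. \<omega> i) \<in> borel_measurable (std_normals (insert r L))" if "i \<in> insert r L" for i
    using measurable_component_singleton[OF that, of "\<lambda>_. std_normal_distribution"] by simp
  show ?thesis
    using m[OF assms] m[of r] by (cases "i = r") (auto simp: star_var_def[abs_def])
qed

text \<open>Both sides of the required identity are explicit: the intersection has the product of
  one-dimensional probabilities as its conditional probability, and each factor is the case of one
  leaf.\<close>

lemma cond_indep_star_var:
  assumes L: "finite L" "r \<notin> L"
  shows "cond_indep_vars (std_normals (insert r L))
    (vimage_algebra (space (std_normals (insert r L))) (star_var r c d r) borel)
    (\<lambda>C. PiM C (\<lambda>_. borel)) (\<lambda>C \<omega>. \<lambda>u\<in>C. star_var r c d u \<omega>) ((\<lambda>i. {i}) ` L)"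
proof -
  let ?N = "std_normals (insert r L)"
  let ?G = "vimage_algebra (space ?N) (\<lambda>\<omega>. \<omega> r) borel"
  let ?F = "\<lambda>C. {(\<lambda>\<omega>. \<lambda>u\<in>C. star_var r c d u \<omega>) -` A \<inter> space ?N | A. A \<in> sets (PiM C (\<lambda>_. borel))}"
  let ?E = "\<lambda>i B. {\<omega> \<in> space ?N. c i * \<omega> r + d i * \<omega> i \<in> B}"
  have m: "(\<lambda>\<omega>. \<lambda>u\<in>{i}. star_var r c d u \<omega>) \<in> measurable ?N (PiM {i} (\<lambda>_. borel))" if "i \<in> L" for i
    using that by (intro measurable_restrict measurable_star_var) auto
  have F: "\<exists>B \<in> sets borel. A = ?E i B" if i: "i \<in> L" and AF: "A \<in> ?F {i}" for i A
  proof -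
    obtain A' where A': "A' \<in> sets (PiM {i} (\<lambda>_. borel :: real measure))"
        "A = (\<lambda>\<omega>. \<lambda>u\<in>{i}. star_var r c d u \<omega>) -` A' \<inter> space ?N"
      using AF by auto
    \<comment> \<open>Identifying the one-point product with the real line turns an event of the
      component \<open>{i}\<close> into a Borel condition on leaf \<open>i\<close>.\<close>
    have "(\<lambda>x. \<lambda>u\<in>{i}. x) \<in> measurable borel (PiM {i} (\<lambda>_. borel :: real measure))"
      by (intro measurable_restrict) simp
    from measurable_sets[OF this A'(1)]
    have "{x. (\<lambda>u\<in>{i}. x) \<in> A'} \<in> sets borel" by (simp add: vimage_def)
    moreover have "A = ?E i {x. (\<lambda>u\<in>{i}. x) \<in> A'}"
    proof -
      have "(\<lambda>u\<in>{i}. star_var r c d u \<omega>) = (\<lambda>u\<in>{i}. c i * \<omega> r + d i * \<omega> i)" for \<omega>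
        using i L by (auto simp: star_var_def fun_eq_iff restrict_def)
      then show ?thesis unfolding A'(2) by auto
    qed
    ultimately show ?thesis by blast
  qed
  have "AE \<omega> in ?N. real_cond_exp ?N ?G (indicator (\<Inter>j\<in>J. A j)) \<omega> =
          (\<Prod>j\<in>J. real_cond_exp ?N ?G (indicator (A j)) \<omega>)"
    if J: "J \<subseteq> (\<lambda>i. {i}) ` L" "J \<noteq> {}" and A: "A \<in> Pi J ?F" for J A
  proof -
    define K where "K = {i\<in>L. {i} \<in> J}"
    have K: "K \<subseteq> L" "J = (\<lambda>i. {i}) ` K" "K \<noteq> {}" "finite K"
      using J L by (auto simp: K_def)
    have "\<forall>i\<in>K. \<exists>B. B \<in> sets borel \<and> A {i} = ?E i B"
    proof
      fix i assume "i \<in> K"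
      then have "i \<in> L" "A {i} \<in> ?F {i}" using Pi_mem[OF A, of "{i}"] by (simp_all add: K_def)
      from F[OF this] show "\<exists>B. B \<in> sets borel \<and> A {i} = ?E i B" by blast
    qed
    from bchoice[OF this] obtain B
      where B: "\<And>i. i \<in> K \<Longrightarrow> B i \<in> sets borel" "\<And>i. i \<in> K \<Longrightarrow> A {i} = ?E i (B i)"
      by blast
    have inter: "(\<Inter>j\<in>J. A j) = {\<omega> \<in> space ?N. \<forall>i\<in>K. c i * \<omega> r + d i * \<omega> i \<in> B i}"
      unfolding K(2) using B(2) K(3) by auto
    have "AE \<omega> in ?N. real_cond_exp ?N ?G (indicator (\<Inter>j\<in>J. A j)) \<omega>
        = (\<Prod>i\<in>K. measure std_normal_distribution {x. c i * \<omega> r + d i * x \<in> B i})"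
      unfolding inter by (rule std_normals_cond_exp[OF L K(1) B(1)])
    moreover have "AE \<omega> in ?N. \<forall>i\<in>K. real_cond_exp ?N ?G (indicator (A {i})) \<omega>
        = measure std_normal_distribution {x. c i * \<omega> r + d i * x \<in> B i}"
    proof (rule AE_finite_allI[OF K(4)])
      fix i assume i: "i \<in> K"
      then have "{i} \<subseteq> L" and Bi: "\<And>j. j \<in> {i} \<Longrightarrow> B j \<in> sets borel" using K B by auto
      from std_normals_cond_exp[OF L, of "{i}" B c d, OF this]
      show "AE \<omega> in ?N. real_cond_exp ?N ?G (indicator (A {i})) \<omega>
          = measure std_normal_distribution {x. c i * \<omega> r + d i * x \<in> B i}"
        unfolding B(2)[OF i] by simp
    qed
    ultimately show ?thesis
    proof eventually_elim
      case (elim \<omega>)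
      have "(\<Prod>j\<in>J. real_cond_exp ?N ?G (indicator (A j)) \<omega>)
          = (\<Prod>i\<in>K. real_cond_exp ?N ?G (indicator (A {i})) \<omega>)"
        unfolding K(2) by (subst prod.reindex) (auto simp: inj_on_def)
      also have "\<dots> = (\<Prod>i\<in>K. measure std_normal_distribution {x. c i * \<omega> r + d i * x \<in> B i})"
        using elim(2) by (intro prod.cong) auto
      finally show ?case using elim(1) by simp
    qed
  qed
  note AE_eq = this
  have root: "star_var r c d r = (\<lambda>\<omega>. \<omega> r)" by (simp add: fun_eq_iff star_var_def)
  show ?thesis
    unfolding cond_indep_vars_def cond_indep_sets_def root
  proof (intro conjI ballI allI impI)
    fix C assume "C \<in> (\<lambda>i. {i}) ` L"
    then have C: "(\<lambda>\<omega>. \<lambda>u\<in>C. star_var r c d u \<omega>) \<in> measurable ?N (PiM C (\<lambda>_. borel))"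
      using m by blast
    then show "(\<lambda>\<omega>. \<lambda>u\<in>C. star_var r c d u \<omega>) \<in> measurable ?N (PiM C (\<lambda>_. borel))" .
    show "?F C \<subseteq> sets ?N" using measurable_sets[OF C] by blast
  qed (rule AE_eq)
qed

lemma sum_star_var:
  assumes L: "finite L" "r \<notin> L"
  shows "(\<Sum>i\<in>L. k i * star_var r c d i \<omega>)
    = (\<Sum>i\<in>insert r L. ((\<lambda>i. k i * d i)(r := \<Sum>i\<in>L. k i * c i)) i * \<omega> i)"
proof -
  have "(\<Sum>i\<in>L. k i * star_var r c d i \<omega>) = (\<Sum>i\<in>L. k i * c i * \<omega> r + k i * d i * \<omega> i)"
    using L by (intro sum.cong refl) (auto simp: star_var_def algebra_simps)
  also have "\<dots> = (\<Sum>i\<in>L. k i * c i) * \<omega> r + (\<Sum>i\<in>L. k i * d i * \<omega> i)"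
    by (simp add: sum.distrib sum_distrib_right)
  also have "(\<Sum>i\<in>L. k i * d i * \<omega> i) = (\<Sum>i\<in>L. ((\<lambda>i. k i * d i)(r := \<Sum>i\<in>L. k i * c i)) i * \<omega> i)"
    using L by (intro sum.cong refl) auto
  finally show ?thesis using L by simp
qed

lemma distr_sum_star_var:
  assumes L: "finite L" "r \<notin> L"
  shows "distr (std_normals (insert r L)) borel (\<lambda>\<omega>. \<Sum>i\<in>L. k i * star_var r c d i \<omega>)
    = distr std_normal_distribution borel ((*) (sqrt ((\<Sum>i\<in>L. k i * c i)\<^sup>2 + (\<Sum>i\<in>L. (k i * d i)\<^sup>2))))"
proof -
  let ?e = "(\<lambda>i. k i * d i)(r := \<Sum>i\<in>L. k i * c i)"
  have "(\<Sum>i\<in>L. (?e i)\<^sup>2) = (\<Sum>i\<in>L. (k i * d i)\<^sup>2)"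
    using L by (intro sum.cong refl) auto
  then have "(\<Sum>i\<in>insert r L. (?e i)\<^sup>2) = (\<Sum>i\<in>L. k i * c i)\<^sup>2 + (\<Sum>i\<in>L. (k i * d i)\<^sup>2)"
    using L by simp
  then show ?thesis
    unfolding sum_star_var[OF L] using distr_sum_std_normal[of "insert r L" ?e] L by simp
qed

lemma jointly_gaussian_star_var:
  assumes L: "finite L" "r \<notin> L"
  shows "jointly_gaussian (std_normals (insert r L)) (insert r L) (star_var r c d)"
  unfolding jointly_gaussian_def
proof (intro conjI ballI allI)
  show "star_var r c d i \<in> borel_measurable (std_normals (insert r L))" if "i \<in> insert r L" for i
    by (rule measurable_star_var[OF that])
  fix k :: "'a \<Rightarrow> real"
  let ?S = "\<lambda>\<omega>. \<Sum>i\<in>insert r L. k i * star_var r c d i \<omega>"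
  \<comment> \<open>The coefficient of the hub normal is its own \<open>k r\<close> plus what the
    leaves pass on through \<open>c\<close>.\<close>
  let ?e = "(\<lambda>i. k i * d i)(r := k r + (\<Sum>i\<in>L. k i * c i))"
  have "?S \<omega> = (\<Sum>i\<in>insert r L. ?e i * \<omega> i)" for \<omega>
  proof -
    have "?S \<omega> = k r * \<omega> r + (\<Sum>i\<in>insert r L. ((\<lambda>i. k i * d i)(r := \<Sum>i\<in>L. k i * c i)) i * \<omega> i)"
      using L by (simp add: sum_star_var star_var_def[of r c d r])
    moreover have "(\<Sum>i\<in>L. ((\<lambda>i. k i * d i)(r := \<Sum>i\<in>L. k i * c i)) i * \<omega> i) = (\<Sum>i\<in>L. ?e i * \<omega> i)"
      using L by (intro sum.cong refl) auto
    ultimately show ?thesis using L by (simp add: distrib_right)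
  qed
  then have S: "?S = (\<lambda>\<omega>. \<Sum>i\<in>insert r L. ?e i * \<omega> i)" by blast
  have "?S \<in> borel_measurable (std_normals (insert r L))"
    by (intro borel_measurable_sum borel_measurable_times borel_measurable_const measurable_star_var)
  moreover have "0 \<le> sqrt (\<Sum>i\<in>insert r L. (?e i)\<^sup>2)"
    by (intro real_sqrt_ge_zero sum_nonneg zero_le_power2)
  moreover have "distr (std_normals (insert r L)) borel ?S
      = distr std_normal_distribution borel ((*) (sqrt (\<Sum>i\<in>insert r L. (?e i)\<^sup>2)))"
    unfolding S using L(1) by (intro distr_sum_std_normal) simp
  ultimately show "gaussian_var (std_normals (insert r L)) ?S"
    by (rule gaussian_varI[OF prob_space_PiM[OF prob_space_std_normal]])
qed (use L in simp)

lemma gauss_markov_tree_star: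
  assumes L: "finite L" "r \<notin> L"
  shows "gauss_markov_tree (std_normals (insert r L)) (star_graph r L) (star_var r c d)"
  unfolding gauss_markov_tree_def
proof (intro conjI ballI)
  let ?N = "std_normals (insert r L)"
  show "prob_space ?N" by (intro prob_space_PiM prob_space_std_normal)
  show "undirected_tree (star_graph r L)" by (rule undirected_tree_star_graph[OF L])
  show "jointly_gaussian ?N (pverts (star_graph r L)) (star_var r c d)"
    using jointly_gaussian_star_var[OF L] by simp
  fix v assume "v \<in> pverts (star_graph r L)"
  then consider "v = r" | "v \<in> L" by auto
  then show "cond_indep_vars ?N (vimage_algebra (space ?N) (star_var r c d v) borel)
      (\<lambda>C. PiM C (\<lambda>_. borel)) (\<lambda>C \<omega>. \<lambda>u\<in>C. star_var r c d u \<omega>) (components_without (star_graph r L) v)"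
  proof cases
    case 1
    then show ?thesis
      using cond_indep_star_var[OF L] by (simp add: components_without_root[OF L(2)])
  next
    case 2
    show ?thesis
      using components_without_leaf[OF 2 L(2)]
      by (intro cond_indep_vars_single measurable_restrict measurable_star_var) auto
  qed
qed

section \<open>Regression equations and the final assembly\<close>

text \<open>These are the normal equations: \<open>X\<close> and \<open>Y\<close> are measurable for
  the conditioning algebra, so integrating either of them against \<open>Z\<close> or against its
  conditional expectation gives the same value.\<close>

lemma cond_exp_given2_linear:
  assumes M: "prob_space M"
    and m[measurable]: "X \<in> borel_measurable M" "Y \<in> borel_measurable M" "Z \<in> borel_measurable M"
    and i: "integrable M (\<lambda>\<omega>. (X \<omega>)\<^sup>2)" "integrable M (\<lambda>\<omega>. (Y \<omega>)\<^sup>2)" "integrable M (\<lambda>\<omega>. (Z \<omega>)\<^sup>2)"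
    and eq: "AE \<omega> in M. cond_exp_given2 M Z X Y \<omega> = a1 * X \<omega> + a2 * Y \<omega>"
  shows "(LINT \<omega>|M. X \<omega> * Z \<omega>) = a1 * (LINT \<omega>|M. (X \<omega>)\<^sup>2) + a2 * (LINT \<omega>|M. X \<omega> * Y \<omega>)"
    and "(LINT \<omega>|M. Y \<omega> * Z \<omega>) = a1 * (LINT \<omega>|M. X \<omega> * Y \<omega>) + a2 * (LINT \<omega>|M. (Y \<omega>)\<^sup>2)"
proof -
  interpret prob_space M by fact
  let ?G = "vimage_algebra (space M) (\<lambda>\<omega>. (X \<omega>, Y \<omega>)) borel"
  have XY: "(\<lambda>\<omega>. (X \<omega>, Y \<omega>)) \<in> measurable M borel" by (rule borel_measurable_Pair) fact+
  interpret G: finite_measure_subalgebra M ?G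
    by unfold_locales (auto simp: subalgebra_def sets_vimage_algebra2 measurable_sets[OF XY])
  have fst_m: "fst \<in> borel_measurable (borel :: (real \<times> real) measure)"
    and snd_m: "snd \<in> borel_measurable (borel :: (real \<times> real) measure)"
    by (simp_all add: borel_prod[symmetric])
  have "(\<lambda>\<omega>. (X \<omega>, Y \<omega>)) \<in> measurable ?G borel" by (rule measurable_vimage_algebra1) simp
  from measurable_compose[OF this fst_m] measurable_compose[OF this snd_m]
  have G: "X \<in> borel_measurable ?G" "Y \<in> borel_measurable ?G" by simp_all
  have [measurable]: "real_cond_exp M ?G Z \<in> borel_measurable M" by simp
  note int = integrable_mult_square_integrable[OF _ _ i(1) i(3)] integrable_mult_square_integrable[OF _ _ i(2) i(3)]
    integrable_mult_square_integrable[OF _ _ i(1) i(2)]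
  have proj: "(LINT \<omega>|M. W \<omega> * Z \<omega>) = (LINT \<omega>|M. a1 * (W \<omega> * X \<omega>) + a2 * (W \<omega> * Y \<omega>))"
    if W: "W \<in> borel_measurable ?G" "W \<in> borel_measurable M" "integrable M (\<lambda>\<omega>. W \<omega> * Z \<omega>)" for W
  proof -
    note [measurable] = W(2)
    have "(LINT \<omega>|M. W \<omega> * Z \<omega>) = (LINT \<omega>|M. W \<omega> * real_cond_exp M ?G Z \<omega>)"
      by (rule G.real_cond_exp_intg(2)[symmetric]) (fact W m)+
    also have "\<dots> = (LINT \<omega>|M. a1 * (W \<omega> * X \<omega>) + a2 * (W \<omega> * Y \<omega>))"
    proof (rule integral_cong_AE)
      show "AE \<omega> in M. W \<omega> * real_cond_exp M ?G Z \<omega> = a1 * (W \<omega> * X \<omega>) + a2 * (W \<omega> * Y \<omega>)"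
        using eq unfolding cond_exp_given2_def by eventually_elim (simp add: algebra_simps)
    qed measurable
    finally show ?thesis .
  qed
  have XZ: "integrable M (\<lambda>\<omega>. X \<omega> * Z \<omega>)" and YZ: "integrable M (\<lambda>\<omega>. Y \<omega> * Z \<omega>)"
    and XY: "integrable M (\<lambda>\<omega>. X \<omega> * Y \<omega>)"
    by (rule int; fact)+
  have "(LINT \<omega>|M. X \<omega> * Z \<omega>) = (LINT \<omega>|M. a1 * (X \<omega>)\<^sup>2 + a2 * (X \<omega> * Y \<omega>))"
    unfolding power2_eq_square by (rule proj[OF G(1) m(1) XZ])
  then show "(LINT \<omega>|M. X \<omega> * Z \<omega>) = a1 * (LINT \<omega>|M. (X \<omega>)\<^sup>2) + a2 * (LINT \<omega>|M. X \<omega> * Y \<omega>)"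
    using i XY by simp
  have "(LINT \<omega>|M. Y \<omega> * Z \<omega>) = (LINT \<omega>|M. a1 * (X \<omega> * Y \<omega>) + a2 * (Y \<omega>)\<^sup>2)"
    unfolding power2_eq_square mult.commute[of "X _" "Y _"] by (rule proj[OF G(2) m(2) YZ])
  then show "(LINT \<omega>|M. Y \<omega> * Z \<omega>) = a1 * (LINT \<omega>|M. X \<omega> * Y \<omega>) + a2 * (LINT \<omega>|M. (Y \<omega>)\<^sup>2)"
    using i XY by simp
qed

text \<open>Distinct leaves share only the hub, which produces the covariance
  \<open>c i * c j\<close>; independent noise fills each variance up to its prescribed value. The
  condition \<open>0 \<notin> I\<close> leaves 0 free as the name of the hub.\<close>

lemma embeddable_of_star_covariance:
  fixes X :: "nat \<Rightarrow> 'a \<Rightarrow> real"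
  assumes M: "prob_space M" and X: "jointly_gaussian M I X" and I: "0 \<notin> I"
    and mean: "\<And>i. i \<in> I \<Longrightarrow> prob_space.expectation M (X i) = 0"
    and cov: "\<And>i j. i \<in> I \<Longrightarrow> j \<in> I \<Longrightarrow> i \<noteq> j \<Longrightarrow> (LINT \<omega>|M. X i \<omega> * X j \<omega>) = c i * c j"
    and var: "\<And>i. i \<in> I \<Longrightarrow> (c i)\<^sup>2 \<le> (LINT \<omega>|M. (X i \<omega>)\<^sup>2)"
  shows "embeddable_in_gauss_markov_tree M I X"
proof -
  have fin: "finite I" using X by (simp add: jointly_gaussian_def)
  define d where "d i = sqrt ((LINT \<omega>|M. (X i \<omega>)\<^sup>2) - (c i)\<^sup>2)" for i
  have d2: "(d i)\<^sup>2 = (LINT \<omega>|M. (X i \<omega>)\<^sup>2) - (c i)\<^sup>2" if "i \<in> I" for i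
    using var[OF that] by (simp add: d_def)
  let ?N = "std_normals (insert 0 I)"
  let ?Y = "star_var 0 c d"
  have "distr M (PiM I (\<lambda>_. borel)) (\<lambda>\<omega>. \<lambda>i\<in>I. X i \<omega>) = distr ?N (PiM I (\<lambda>_. borel)) (\<lambda>\<omega>. \<lambda>i\<in>I. ?Y i \<omega>)"
  proof (rule cramer_wold[OF M _ fin])
    show "prob_space ?N" by (intro prob_space_PiM prob_space_std_normal)
    show "X i \<in> borel_measurable M" if "i \<in> I" for i
      using X that by (simp add: jointly_gaussian_def)
    show "?Y i \<in> borel_measurable ?N" if "i \<in> I" for i
      by (rule measurable_star_var) (simp add: that)
    fix k :: "nat \<Rightarrow> real"
    \<comment> \<open>One row of the quadratic form: the covariance matrix is the rank-one matrix of
      the \<open>c i\<close> plus a diagonal of noise variances.\<close>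
    have "(\<Sum>j\<in>I. k i * k j * (LINT \<omega>|M. X i \<omega> * X j \<omega>))
        = (\<Sum>j\<in>I. k i * c i * (k j * c j)) + (k i * d i)\<^sup>2" if i: "i \<in> I" for i
    proof -
      have "(\<Sum>j\<in>I. k i * k j * (LINT \<omega>|M. X i \<omega> * X j \<omega>))
          = (\<Sum>j\<in>I. k i * c i * (k j * c j) + (if j = i then (k i * d i)\<^sup>2 else 0))"
      proof (rule sum.cong[OF refl])
        fix j assume j: "j \<in> I"
        show "k i * k j * (LINT \<omega>|M. X i \<omega> * X j \<omega>)
            = k i * c i * (k j * c j) + (if j = i then (k i * d i)\<^sup>2 else 0)"
        proof (cases "j = i")
          case True
          then show ?thesis
            using d2[OF i] by (simp add: power_mult_distrib) (simp add: power2_eq_square algebra_simps)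
        next
          case False
          then show ?thesis using cov[OF i j] by simp
        qed
      qed
      then show ?thesis using fin i by (simp add: sum.distrib)
    qed
    then have "(\<Sum>i\<in>I. \<Sum>j\<in>I. k i * k j * (LINT \<omega>|M. X i \<omega> * X j \<omega>))
        = (\<Sum>i\<in>I. k i * c i)\<^sup>2 + (\<Sum>i\<in>I. (k i * d i)\<^sup>2)"
      by (simp add: sum.distrib power2_eq_square[of "sum _ _"] sum_product)
    moreover have "distr M borel (\<lambda>\<omega>. \<Sum>i\<in>I. k i * X i \<omega>) = distr std_normal_distribution borel
        ((*) (sqrt (\<Sum>i\<in>I. \<Sum>j\<in>I. k i * k j * (LINT \<omega>|M. X i \<omega> * X j \<omega>))))"
      by (rule jointly_gaussian_law(4)[OF M X]) (rule mean)
    ultimately show "distr M borel (\<lambda>\<omega>. \<Sum>i\<in>I. k i * X i \<omega>) = distr ?N borel (\<lambda>\<omega>. \<Sum>i\<in>I. k i * ?Y i \<omega>)"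
      unfolding distr_sum_star_var[OF fin I] by (simp only:)
  qed
  moreover have "gauss_markov_tree ?N (star_graph 0 I) ?Y" by (rule gauss_markov_tree_star[OF fin I])
  moreover have "inj_on (\<lambda>i. i) I" "(\<lambda>i. i) ` I \<subseteq> pverts (star_graph 0 I)" by auto
  ultimately show ?thesis
    unfolding embeddable_in_gauss_markov_tree_def
    by (intro exI[of _ ?N] exI[of _ "star_graph 0 I"] exI[of _ ?Y] exI[of _ "\<lambda>i. i"] conjI)
qed

theorem proposition4:
  fixes M :: "'a measure" and X :: "nat \<Rightarrow> 'a \<Rightarrow> real"
  assumes "prob_space M"
    and "jointly_gaussian M {1, 2, 3} X"
    and "\<And>i. i \<in> {1, 2, 3} \<Longrightarrow> prob_space.expectation M (X i) = 0"
    and "\<not> embeddable_in_gauss_markov_tree M {1, 2, 3} X"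
  shows "\<exists>\<pi>. \<pi> permutes {1, 2, 3} \<and>
    (\<forall>a1 a2 :: real.
      (AE \<omega> in M. cond_exp_given2 M (X (\<pi> 3)) (X (\<pi> 1)) (X (\<pi> 2)) \<omega> =
                   a1 * X (\<pi> 1) \<omega> + a2 * X (\<pi> 2) \<omega>) \<longrightarrow>
      a1 * a2 * prob_space.expectation M (\<lambda>\<omega>. X (\<pi> 1) \<omega> * X (\<pi> 2) \<omega>) < 0)"
proof (rule ccontr)
  assume contra: "\<not> ?thesis"
  interpret prob_space M by fact
  note law = jointly_gaussian_law[OF assms(1,2)]
  have X_meas: "X i \<in> borel_measurable M" and X_sq: "integrable M (\<lambda>\<omega>. (X i \<omega>)\<^sup>2)"
    if "i \<in> {1, 2, 3}" for i
    by (rule law(1)[OF assms(3) that] law(3)[OF assms(3) that]; assumption)+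
  define s where "s i j = (LINT \<omega>|M. X i \<omega> * X j \<omega>)" for i j
  have s_sym: "s i j = s j i" for i j by (simp add: s_def mult.commute)
  have s_diag: "s i i = (LINT \<omega>|M. (X i \<omega>)\<^sup>2)" for i by (simp add: s_def power2_eq_square)
  have sign: "(s x z * s y y - s x y * s y z) * (s y z * s x x - s x y * s x z) * s x y \<ge> 0"
    if \<pi>: "\<pi> permutes {1, 2, 3}" "\<pi> 1 = x" "\<pi> 2 = y" "\<pi> 3 = z" for \<pi> x y z
  proof -
    \<comment> \<open>A failing implication hands over coefficients that satisfy its
      premise.\<close>
    have "\<exists>a1 a2. (AE \<omega> in M. cond_exp_given2 M (X (\<pi> 3)) (X (\<pi> 1)) (X (\<pi> 2)) \<omega>
          = a1 * X (\<pi> 1) \<omega> + a2 * X (\<pi> 2) \<omega>) \<and> \<not> a1 * a2 * (LINT \<omega>|M. X (\<pi> 1) \<omega> * X (\<pi> 2) \<omega>) < 0"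
      using contra \<pi>(1) by blast
    then obtain a1 a2 where
      a: "AE \<omega> in M. cond_exp_given2 M (X z) (X x) (X y) \<omega> = a1 * X x \<omega> + a2 * X y \<omega>"
        "a1 * a2 * s x y \<ge> 0"
      unfolding \<pi>(2-4) s_def[symmetric] not_less by blast
    have xyz: "x \<in> {1, 2, 3}" "y \<in> {1, 2, 3}" "z \<in> {1, 2, 3}"
      using permutes_in_image[OF \<pi>(1)] \<pi>(2-4) by blast+
    note xz = cond_exp_given2_linear[OF assms(1) X_meas[OF xyz(1)] X_meas[OF xyz(2)] X_meas[OF xyz(3)]
        X_sq[OF xyz(1)] X_sq[OF xyz(2)] X_sq[OF xyz(3)] a(1), folded s_diag, folded s_def]
    \<comment> \<open>Cramer's rule without the division: both sides vanish when the Gram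
      determinant does.\<close>
    have "s x z * s y y - s x y * s y z = a1 * (s x x * s y y - (s x y)\<^sup>2)"
      "s y z * s x x - s x y * s x z = a2 * (s x x * s y y - (s x y)\<^sup>2)"
      unfolding xz by (simp_all add: power2_eq_square algebra_simps)
    then have "(s x z * s y y - s x y * s y z) * (s y z * s x x - s x y * s x z) * s x y
        = (s x x * s y y - (s x y)\<^sup>2)\<^sup>2 * (a1 * a2 * s x y)"
      by (simp only: power2_eq_square mult_ac)
    then show ?thesis using a(2) by (simp only: mult_nonneg_nonneg zero_le_power2)
  qed
  have tr: "Transposition.transpose a b permutes {1, 2, 3}" if "a \<in> {1, 2, 3}" "b \<in> {1, 2, 3}" for a b :: nat
    using that by (rule permutes_swap_id)
  have cs: "(s i j)\<^sup>2 \<le> s i i * s j j" if "i \<in> {1, 2, 3}" "j \<in> {1, 2, 3}" for i j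
    unfolding s_diag unfolding s_def by (intro integral_mult_square_le X_meas X_sq that)
  obtain c1 c2 c3 where c: "c1 * c2 = s 1 2" "c1 * c3 = s 1 3" "c2 * c3 = s 2 3"
    "c1\<^sup>2 \<le> s 1 1" "c2\<^sup>2 \<le> s 2 2" "c3\<^sup>2 \<le> s 3 3"
  proof (rule star_covariance[of "s 1 1" "s 2 2" "s 3 3" "s 1 2" "s 1 3" "s 2 3"])
    show "0 \<le> s 1 1" "0 \<le> s 2 2" "0 \<le> s 3 3" by (simp_all add: s_diag)
    show "(s 1 2)\<^sup>2 \<le> s 1 1 * s 2 2" "(s 1 3)\<^sup>2 \<le> s 1 1 * s 3 3" "(s 2 3)\<^sup>2 \<le> s 2 2 * s 3 3"
      by (intro cs; simp)+
    \<comment> \<open>The sign condition is symmetric in the two regressors, so three permutations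
      suffice: the identity, and the swaps that put 2 or 1 in the regressed place.\<close>
    have "0 \<le> (s 1 3 * s 2 2 - s 1 2 * s 2 3) * (s 2 3 * s 1 1 - s 1 2 * s 1 3) * s 1 2"
      by (rule sign[OF permutes_id]) simp_all
    then show "0 \<le> (s 1 3 * s 2 2 - s 1 2 * s 2 3) * (s 2 3 * s 1 1 - s 1 2 * s 1 3) * s 1 2" .
    have "0 \<le> (s 1 2 * s 3 3 - s 1 3 * s 3 2) * (s 3 2 * s 1 1 - s 1 3 * s 1 2) * s 1 3"
      by (rule sign[OF tr[of 2 3]]) (simp_all add: Transposition.transpose_def)
    then show "0 \<le> (s 1 2 * s 3 3 - s 1 3 * s 2 3) * (s 2 3 * s 1 1 - s 1 2 * s 1 3) * s 1 3"
      by (simp only: s_sym[of 3 2] mult.commute[of "s 1 3" "s 1 2"])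
    have "0 \<le> (s 3 1 * s 2 2 - s 3 2 * s 2 1) * (s 2 1 * s 3 3 - s 3 2 * s 3 1) * s 3 2"
      by (rule sign[OF tr[of 1 3]]) (simp_all add: Transposition.transpose_def)
    then show "0 \<le> (s 1 2 * s 3 3 - s 1 3 * s 2 3) * (s 1 3 * s 2 2 - s 1 2 * s 2 3) * s 2 3"
      by (simp only: s_sym[of 3 2] s_sym[of 3 1] s_sym[of 2 1] mult_ac)
  qed
  define c where "c = (\<lambda>i::nat. c3)(1 := c1, 2 := c2)"
  have c_simps: "c 1 = c1" "c 2 = c2" "c 3 = c3" by (simp_all add: c_def)
  have "embeddable_in_gauss_markov_tree M {1, 2, 3} X"
  proof (rule embeddable_of_star_covariance[OF assms(1,2) _ assms(3)])
    have "c2 * c1 = s 2 1" "c3 * c1 = s 3 1" "c3 * c2 = s 3 2"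
      using c(1-3) by (simp_all only: mult.commute s_sym)
    then show "(LINT \<omega>|M. X i \<omega> * X j \<omega>) = c i * c j" if "i \<in> {1, 2, 3}" "j \<in> {1, 2, 3}" "i \<noteq> j" for i j
      unfolding s_def[symmetric] using that c(1-3) c_simps by (elim insertE emptyE) (simp_all only:)
    show "(c i)\<^sup>2 \<le> (LINT \<omega>|M. (X i \<omega>)\<^sup>2)" if "i \<in> {1, 2, 3}" for i
      unfolding s_diag[symmetric] using that c(4-6) c_simps by (elim insertE emptyE) (simp_all only:)
  qed simp_all
  then show False using assms(4) by blast
qed

end
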